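(* The function $(p_g,p_i)\mapsto \max_{D_{xz}}\mathcal L_{xz}(D_{xz},p_g,p_i)$ attains its global minimum (over all generators $p_g(x|y,z)$ and all inference conditionals $p_i(z|x)$) at $(p_g,p_i)$ if and only if $p(x)\,p_i(z|x)=p(z)\,p_g(x|z)$ as joint distributions on $\mathcal X\times\mathcal Z$; at such a point the optimal discriminator is $D^*_{xz}=\tfrac12$ (almost everywhere with respect to this common joint distribution). Similarly, the function $p_g\mapsto\max_{D_{xy}}\mathcal L_{xy}(D_{xy},p_g)$ attains its global minimum (over all generators $p_g(x|y,z)$) at $p_g$ if and only if $p(x,y)=p(y)\,p_g(x|y)$ as joint distributions on $\mathcal X\times\mathcal Y$; at such a point the optimal discriminator is $D^*_{xy}=\tfrac12$ (almost everywhere with respect to this common joint distribution).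
   Context: Let $\mathcal X,\mathcal Y,\mathcal Z$ be standard Borel spaces (spaces of data $x$, structured codes $y$, unstructured codes $z$). Let $p(x,y)$ be a fixed probability distribution on $\mathcal X\times\mathcal Y$ (the true joint data distribution) with marginals $p(x)$ and $p(y)$, and let $p(z)$ be a fixed probability distribution (prior) on $\mathcal Z$; under the generative model $y$ and $z$ are independent, $y\sim p(y)$, $z\sim p(z)$. Nonparametric assumption: a generator is an arbitrary Markov kernel $p_g(x|y,z)$ from $\mathcal Y\times\mathcal Z$ to $\mathcal X$, an inference conditional is an arbitrary Markov kernel $p_i(z|x)$ from $\mathcal X$ to $\mathcal Z$, and discriminators are arbitrary measurable functions $D_{xz}:\mathcal X\times\mathcal Z\to[0,1]$ and $D_{xy}:\mathcal X\times\mathcal Y\to[0,1]$ (with $\log 0=-\infty$). The generator induces the conditionals $$p_g(x|z)=\int p(y)\,p_g(x|y,z)\,dy,\qquad p_g(x|y)=\int p(z)\,p_g(x|y,z)\,dz .$$ The objectives are $$\mathcal L_{xz}(D_{xz},p_g,p_i)=\mathbb E_{x\sim p(x),\,z\sim p_i(z|x)}[\log D_{xz}(x,z)]+\mathbb E_{y\sim p(y),\,z\sim p(z),\,x\sim p_g(x|y,z)}[\log(1-D_{xz}(x,z))],$$ $$\mathcal L_{xy}(D_{xy},p_g)=\mathbb E_{(x,y)\sim p(x,y)}[\log D_{xy}(x,y)]+\mathbb E_{y\sim p(y),\,z\sim p(z),\,x\sim p_g(x|y,z)}[\log(1-D_{xy}(x,y))].$$ An optimal discriminator is a maximizer of the objective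 over discriminators for fixed $p_g$ (and $p_i$). *)

theory Defs
  imports "HOL-Probability.Probability"
begin

text \<open>
  Spaces are measures of which only the carrier and the \<open>\<sigma>\<close>-algebra matter. A Markov kernel from
  \<open>M\<close> to \<open>N\<close> is an element of \<open>M \<rightarrow>\<^sub>M prob_algebra N\<close>.
\<close>

definition standard_borel :: "'a measure \<Rightarrow> bool" where
  "standard_borel M \<longleftrightarrow>
     (\<exists>T. completely_metrizable_space T \<and> separable_space T \<and> topspace T = space M \<and>
          sets M = sigma_sets (space M) {U. openin T U})"

definition discriminators :: "'a measure \<Rightarrow> ('a \<Rightarrow> real) set" where
  "discriminators M = {D \<in> borel_measurable M. \<forall>w \<in> space M. 0 \<le> D w \<and> D w \<le> 1}"

text \<open>The logarithm with \<open>log 0 = -\<infinity>\<close>; \<^const>\<open>ln\<close> on the reals has \<open>ln 0 = 0\<close>.\<close>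

definition elog :: "real \<Rightarrow> ereal" where
  "elog t = (if t \<le> 0 then -\<infinity> else ereal (ln t))"

text \<open>
  The Bochner integral is \<open>0\<close> on non-integrable functions, whereas \<open>log D\<close> may have expectation
  \<open>-\<infinity>\<close>. Here expectation is positive part minus negative part; the case \<open>\<infinity> - \<infinity>\<close> does not arise below,
  since the integrands are nonpositive.
\<close>

definition ereal_expectation :: "'a measure \<Rightarrow> ('a \<Rightarrow> ereal) \<Rightarrow> ereal" where
  "ereal_expectation M f =
     enn2ereal (\<integral>\<^sup>+ w. e2ennreal (f w) \<partial>M) - enn2ereal (\<integral>\<^sup>+ w. e2ennreal (- f w) \<partial>M)"

text \<open>
  Throughout, \<open>P\<close> is the data distribution \<open>p(x,y)\<close>, \<open>PZ\<close> the prior \<open>p(z)\<close>, \<open>g\<close> a generator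
  \<open>p\<^sub>g(x|y,z)\<close> and \<open>i\<close> an inference conditional \<open>p\<^sub>i(z|x)\<close>.
\<close>

definition marg_x :: "'x measure \<Rightarrow> ('x \<times> 'y) measure \<Rightarrow> 'x measure" where
  "marg_x X P = distr P X fst"

definition marg_y :: "'y measure \<Rightarrow> ('x \<times> 'y) measure \<Rightarrow> 'y measure" where
  "marg_y Y P = distr P Y snd"

definition gen_given_z ::
  "'y measure \<Rightarrow> ('x \<times> 'y) measure \<Rightarrow> ('y \<times> 'z \<Rightarrow> 'x measure) \<Rightarrow> 'z \<Rightarrow> 'x measure" where
  "gen_given_z Y P g z = do {y \<leftarrow> marg_y Y P; g (y, z)}"

definition gen_given_y ::
  "'z measure \<Rightarrow> ('y \<times> 'z \<Rightarrow> 'x measure) \<Rightarrow> 'y \<Rightarrow> 'x measure" where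
  "gen_given_y PZ g y = do {z \<leftarrow> PZ; g (y, z)}"

text \<open>The joint distributions \<open>p(x) p\<^sub>i(z|x)\<close>, \<open>p(z) p\<^sub>g(x|z)\<close> and \<open>p(y) p\<^sub>g(x|y)\<close>.\<close>

definition inf_joint_xz ::
  "'x measure \<Rightarrow> 'z measure \<Rightarrow> ('x \<times> 'y) measure \<Rightarrow> ('x \<Rightarrow> 'z measure) \<Rightarrow> ('x \<times> 'z) measure" where
  "inf_joint_xz X Z P i = do {x \<leftarrow> marg_x X P; z \<leftarrow> i x; return (X \<Otimes>\<^sub>M Z) (x, z)}"

definition gen_joint_xz ::
  "'x measure \<Rightarrow> 'y measure \<Rightarrow> 'z measure \<Rightarrow> ('x \<times> 'y) measure \<Rightarrow> 'z measure \<Rightarrow>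
   ('y \<times> 'z \<Rightarrow> 'x measure) \<Rightarrow> ('x \<times> 'z) measure" where
  "gen_joint_xz X Y Z P PZ g =
     do {z \<leftarrow> PZ; x \<leftarrow> gen_given_z Y P g z; return (X \<Otimes>\<^sub>M Z) (x, z)}"

definition gen_joint_xy ::
  "'x measure \<Rightarrow> 'y measure \<Rightarrow> ('x \<times> 'y) measure \<Rightarrow> 'z measure \<Rightarrow>
   ('y \<times> 'z \<Rightarrow> 'x measure) \<Rightarrow> ('x \<times> 'y) measure" where
  "gen_joint_xy X Y P PZ g =
     do {y \<leftarrow> marg_y Y P; x \<leftarrow> gen_given_y PZ g y; return (X \<Otimes>\<^sub>M Y) (x, y)}"

text \<open>The law of \<open>(x,y,z)\<close> when \<open>y \<sim> p(y)\<close>, \<open>z \<sim> p(z)\<close> and then \<open>x \<sim> p\<^sub>g(x|y,z)\<close>.\<close>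

definition gen_joint_xyz ::
  "'x measure \<Rightarrow> 'y measure \<Rightarrow> 'z measure \<Rightarrow> ('x \<times> 'y) measure \<Rightarrow> 'z measure \<Rightarrow>
   ('y \<times> 'z \<Rightarrow> 'x measure) \<Rightarrow> ('x \<times> 'y \<times> 'z) measure" where
  "gen_joint_xyz X Y Z P PZ g =
     do {y \<leftarrow> marg_y Y P; z \<leftarrow> PZ; x \<leftarrow> g (y, z); return (X \<Otimes>\<^sub>M (Y \<Otimes>\<^sub>M Z)) (x, y, z)}"

definition loss_xz ::
  "'x measure \<Rightarrow> 'y measure \<Rightarrow> 'z measure \<Rightarrow> ('x \<times> 'y) measure \<Rightarrow> 'z measure \<Rightarrow>
   ('x \<times> 'z \<Rightarrow> real) \<Rightarrow> ('y \<times> 'z \<Rightarrow> 'x measure) \<Rightarrow> ('x \<Rightarrow> 'z measure) \<Rightarrow> ereal" where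
  "loss_xz X Y Z P PZ D g i =
     ereal_expectation (inf_joint_xz X Z P i) (\<lambda>(x, z). elog (D (x, z))) +
     ereal_expectation (gen_joint_xyz X Y Z P PZ g) (\<lambda>(x, y, z). elog (1 - D (x, z)))"

definition loss_xy ::
  "'x measure \<Rightarrow> 'y measure \<Rightarrow> 'z measure \<Rightarrow> ('x \<times> 'y) measure \<Rightarrow> 'z measure \<Rightarrow>
   ('x \<times> 'y \<Rightarrow> real) \<Rightarrow> ('y \<times> 'z \<Rightarrow> 'x measure) \<Rightarrow> ereal" where
  "loss_xy X Y Z P PZ D g =
     ereal_expectation P (\<lambda>(x, y). elog (D (x, y))) +
     ereal_expectation (gen_joint_xyz X Y Z P PZ g) (\<lambda>(x, y, z). elog (1 - D (x, y)))"

definition optimal_xz ::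
  "'x measure \<Rightarrow> 'y measure \<Rightarrow> 'z measure \<Rightarrow> ('x \<times> 'y) measure \<Rightarrow> 'z measure \<Rightarrow>
   ('y \<times> 'z \<Rightarrow> 'x measure) \<Rightarrow> ('x \<Rightarrow> 'z measure) \<Rightarrow> ('x \<times> 'z \<Rightarrow> real) \<Rightarrow> bool" where
  "optimal_xz X Y Z P PZ g i D \<longleftrightarrow>
     is_arg_max (\<lambda>D. loss_xz X Y Z P PZ D g i) (\<lambda>D. D \<in> discriminators (X \<Otimes>\<^sub>M Z)) D"

definition optimal_xy ::
  "'x measure \<Rightarrow> 'y measure \<Rightarrow> 'z measure \<Rightarrow> ('x \<times> 'y) measure \<Rightarrow> 'z measure \<Rightarrow>
   ('y \<times> 'z \<Rightarrow> 'x measure) \<Rightarrow> ('x \<times> 'y \<Rightarrow> real) \<Rightarrow> bool" where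
  "optimal_xy X Y Z P PZ g D \<longleftrightarrow>
     is_arg_max (\<lambda>D. loss_xy X Y Z P PZ D g) (\<lambda>D. D \<in> discriminators (X \<Otimes>\<^sub>M Y)) D"

text \<open>
  The maxima are written as suprema; that they are attained, i.e. that an optimal discriminator
  exists, is part of the theorem.
\<close>

definition max_loss_xz ::
  "'x measure \<Rightarrow> 'y measure \<Rightarrow> 'z measure \<Rightarrow> ('x \<times> 'y) measure \<Rightarrow> 'z measure \<Rightarrow>
   ('y \<times> 'z \<Rightarrow> 'x measure) \<Rightarrow> ('x \<Rightarrow> 'z measure) \<Rightarrow> ereal" where
  "max_loss_xz X Y Z P PZ g i = (SUP D \<in> discriminators (X \<Otimes>\<^sub>M Z). loss_xz X Y Z P PZ D g i)"

definition max_loss_xy ::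
  "'x measure \<Rightarrow> 'y measure \<Rightarrow> 'z measure \<Rightarrow> ('x \<times> 'y) measure \<Rightarrow> 'z measure \<Rightarrow>
   ('y \<times> 'z \<Rightarrow> 'x measure) \<Rightarrow> ereal" where
  "max_loss_xy X Y Z P PZ g = (SUP D \<in> discriminators (X \<Otimes>\<^sub>M Y). loss_xy X Y Z P PZ D g)"

definition global_min_xz ::
  "'x measure \<Rightarrow> 'y measure \<Rightarrow> 'z measure \<Rightarrow> ('x \<times> 'y) measure \<Rightarrow> 'z measure \<Rightarrow>
   ('y \<times> 'z \<Rightarrow> 'x measure) \<Rightarrow> ('x \<Rightarrow> 'z measure) \<Rightarrow> bool" where
  "global_min_xz X Y Z P PZ g i \<longleftrightarrow>
     is_arg_min (\<lambda>(g, i). max_loss_xz X Y Z P PZ g i)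
       (\<lambda>(g, i). g \<in> Y \<Otimes>\<^sub>M Z \<rightarrow>\<^sub>M prob_algebra X \<and> i \<in> X \<rightarrow>\<^sub>M prob_algebra Z) (g, i)"

definition global_min_xy ::
  "'x measure \<Rightarrow> 'y measure \<Rightarrow> 'z measure \<Rightarrow> ('x \<times> 'y) measure \<Rightarrow> 'z measure \<Rightarrow>
   ('y \<times> 'z \<Rightarrow> 'x measure) \<Rightarrow> bool" where
  "global_min_xy X Y Z P PZ g \<longleftrightarrow>
     is_arg_min (\<lambda>g. max_loss_xy X Y Z P PZ g) (\<lambda>g. g \<in> Y \<Otimes>\<^sub>M Z \<rightarrow>\<^sub>M prob_algebra X) g"

end

theory Submission
  imports Defs
begin

text \<open>
  Writing both expectations over the two joint laws \<open>M\<close> and \<open>N\<close> that the discriminator compares, and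
  \<open>a\<close> for the density of \<open>M\<close> with respect to \<open>M + N\<close>, the negated objective is the integral of the
  cross entropy between \<open>a\<close> and \<open>D\<close>. By Gibbs' inequality it is minimal at \<open>D = a\<close>, where it is the
  integral of the binary entropy of \<open>a\<close>; as \<open>M + N\<close> has mass 2, this is at most \<open>2 ln 2\<close>, with equality
  iff \<open>a = 1/2\<close> almost everywhere, i.e. iff \<open>M = N\<close>. Hence the global minimisers are the points with
  \<open>M = N\<close> as soon as one such point exists. For \<open>(x, z)\<close> the independent coupling does, with
  \<open>p\<^sub>g(x|y,z) = p(x)\<close> and \<open>p\<^sub>i(z|x) = p(z)\<close>; for \<open>(x, y)\<close> one takes \<open>p\<^sub>g(x|y,z) = p(x|y)\<close>, a disintegration
  of the data distribution. That exists because a standard Borel space embeds measurably into the unit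
  interval with a measurable left inverse, where conditional quantile functions are available.
\<close>

section \<open>Binary cross entropy and the optimal discriminator\<close>

text \<open>Discriminators take values at most 1, so their negated logarithms are nonnegative. With
  values in \<open>ennreal\<close> every expectation becomes a nonnegative integral, which always
  exists and may be \<infinity>.\<close>

definition nlog :: "real \<Rightarrow> ennreal" where
  "nlog t = e2ennreal (- elog t)"

lemma nlog_nonpos: "t \<le> 0 \<Longrightarrow> nlog t = \<infinity>"
  by (simp add: nlog_def elog_def)

lemma nlog_pos: "0 < t \<Longrightarrow> nlog t = ennreal (- ln t)"
  by (simp add: nlog_def elog_def ennreal_def)

lemma elog_measurable [measurable]: "elog \<in> borel_measurable borel"
  unfolding elog_def[abs_def] by measurable

lemma nlog_measurable [measurable]: "nlog \<in> borel_measurable borel"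
  unfolding nlog_def[abs_def] by measurable

text \<open>As \<open>elog\<close> is nonpositive up to 1, the positive part vanishes and only the
  negated integral of the negative part remains.\<close>

lemma ereal_expectation_elog:
  assumes "\<And>w. w \<in> space M \<Longrightarrow> f w \<le> 1"
  shows "ereal_expectation M (\<lambda>w. elog (f w)) = - enn2ereal (\<integral>\<^sup>+ w. nlog (f w) \<partial>M)"
proof -
  have "e2ennreal (elog (f w)) = 0" if "w \<in> space M" for w
    using assms[OF that] by (auto simp: elog_def e2ennreal_neg)
  then have "(\<integral>\<^sup>+ w. e2ennreal (elog (f w)) \<partial>M) = 0"
    by (simp cong: nn_integral_cong)
  then show ?thesis
    by (simp add: ereal_expectation_def nlog_def zero_ennreal.rep_eq)
qed

text \<open>The negated objective: maximising a sum of possibly infinite expectations becomes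
  minimising a nonnegative integral.\<close>

definition gan_cost :: "'a measure \<Rightarrow> 'a measure \<Rightarrow> ('a \<Rightarrow> real) \<Rightarrow> ennreal" where
  "gan_cost M N D = (\<integral>\<^sup>+ w. nlog (D w) \<partial>M) + (\<integral>\<^sup>+ w. nlog (1 - D w) \<partial>N)"

lemma uminus_enn2ereal_add:
  "- enn2ereal a + - enn2ereal b = - enn2ereal (a + b)"
proof -
  have "0 \<le> enn2ereal a" "0 \<le> enn2ereal b" by simp_all
  then show ?thesis
    unfolding plus_ennreal.rep_eq by (cases "enn2ereal a"; cases "enn2ereal b") auto
qed

section \<open>Binary entropy and Gibbs' inequality\<close>

definition binent :: "real \<Rightarrow> real" where
  "binent a = - (a * ln a) - (1 - a) * ln (1 - a)"

lemma binent_measurable [measurable]: "binent \<in> borel_measurable borel"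
  unfolding binent_def[abs_def] by measurable

text \<open>This is \<open>ln t \<le> t - 1\<close> at \<open>t = b / a\<close>, multiplied by
  \<open>a\<close>. Adding the instances for \<open>(a, b)\<close> and \<open>(1 - a, 1 - b)\<close>
  cancels the left sides and gives Gibbs' inequality for two-point distributions. At
  \<open>a = 0\<close> the product \<open>a * ln a\<close> is 0, as it should be.\<close>

lemma mult_ln_ge:
  fixes a b :: real
  assumes "0 \<le> a" "0 < b"
  shows "a - b \<le> a * ln a - a * ln b"
proof (cases "a = 0")
  case False
  then have "0 < a" using assms by simp
  have "ln (b / a) \<le> b / a - 1"
    using \<open>0 < a\<close> assms by (intro ln_le_minus_one) simp
  then have "a * ln (b / a) \<le> a * (b / a - 1)"
    using \<open>0 < a\<close> by (intro mult_left_mono) auto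
  also have "\<dots> = b - a" using \<open>0 < a\<close> by (simp add: field_simps)
  finally show ?thesis
    using \<open>0 < a\<close> assms by (simp add: ln_div algebra_simps)
qed (use assms in auto)

lemma mult_ln_gt:
  fixes a b :: real
  assumes "0 \<le> a" "0 < b" "a \<noteq> b"
  shows "a - b < a * ln a - a * ln b"
proof (cases "a = 0")
  case False
  then have "0 < a" using assms by simp
  have "ln (b / a) \<noteq> b / a - 1"
    using ln_eq_minus_one[of "b / a"] \<open>0 < a\<close> assms by auto
  moreover have "ln (b / a) \<le> b / a - 1"
    using \<open>0 < a\<close> assms by (intro ln_le_minus_one) simp
  ultimately have "a * ln (b / a) < a * (b / a - 1)"
    using \<open>0 < a\<close> by (intro mult_strict_left_mono) auto
  also have "\<dots> = b - a" using \<open>0 < a\<close> by (simp add: field_simps)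
  finally show ?thesis
    using \<open>0 < a\<close> assms by (simp add: ln_div algebra_simps)
qed (use assms in auto)

lemma binent_nonneg: "0 \<le> a \<Longrightarrow> a \<le> 1 \<Longrightarrow> 0 \<le> binent a"
proof -
  assume a: "0 \<le> a" "a \<le> 1"
  have "x * ln x \<le> 0" if "0 \<le> x" "x \<le> 1" for x :: real
    using that by (cases "x = 0") (auto intro!: mult_nonneg_nonpos)
  from this[of a] this[of "1 - a"] a show ?thesis by (simp add: binent_def)
qed

text \<open>Gibbs' inequality against the uniform distribution on two points.\<close>

lemma binent_le_ln2:
  assumes "0 \<le> a" "a \<le> 1"
  shows "binent a \<le> ln 2"
  using mult_ln_ge[of a "1/2"] mult_ln_ge[of "1 - a" "1/2"] assms
  by (simp add: binent_def ln_div algebra_simps)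

text \<open>Strictness in one of the two summands suffices.\<close>

lemma binent_less_ln2:
  assumes "0 \<le> a" "a \<le> 1" "a \<noteq> 1/2"
  shows "binent a < ln 2"
  using mult_ln_gt[of a "1/2"] mult_ln_ge[of "1 - a" "1/2"] assms
  by (simp add: binent_def ln_div algebra_simps)

lemma binent_half: "binent (1 / 2) = ln 2"
  by (simp add: binent_def ln_div)

lemma ennreal_mult_nlog:
  assumes "0 \<le> a" "0 < b" "b \<le> 1"
  shows "ennreal a * nlog b = ennreal (a * - ln b)"
proof -
  have "0 \<le> - ln b" using assms by simp
  then show ?thesis using assms(1) unfolding nlog_pos[OF assms(2)] by (intro ennreal_mult[symmetric])
qed

lemma nlog_cross_entropy_eq:
  assumes "0 \<le> a" "a \<le> 1" "0 < b" "b < 1"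
  shows "ennreal a * nlog b + ennreal (1 - a) * nlog (1 - b) =
    ennreal (- (a * ln b) - (1 - a) * ln (1 - b))"
proof -
  have "ennreal a * nlog b + ennreal (1 - a) * nlog (1 - b) =
    ennreal (a * - ln b) + ennreal ((1 - a) * - ln (1 - b))"
    using ennreal_mult_nlog[of a b] ennreal_mult_nlog[of "1 - a" "1 - b"] assms by simp
  also have "\<dots> = ennreal (a * - ln b + (1 - a) * - ln (1 - b))"
    using assms by (intro ennreal_plus[symmetric] mult_nonneg_nonneg) auto
  finally show ?thesis by simp
qed

lemma nlog_half_add: "nlog (1 / 2) + nlog (1 - 1 / 2) = ennreal (2 * ln 2)"
  by (simp add: nlog_pos ln_div flip: ennreal_plus)

text \<open>Cross entropy dominates entropy, also for a discriminator value \<open>b\<close> at an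
  end point, where the logarithms are infinite.\<close>

lemma nlog_cross_entropy_ge:
  assumes "0 \<le> a" "a \<le> 1" "0 \<le> b" "b \<le> 1"
  shows "ennreal (binent a) \<le> ennreal a * nlog b + ennreal (1 - a) * nlog (1 - b)"
\<comment> \<open>At an end point the right side is \<infinity> unless \<open>a = b\<close>, and
  then both sides are 0 because \<open>0 * \<infinity> = 0\<close> in
  \<open>ennreal\<close>.\<close>
proof (cases "b = 0 \<or> b = 1")
  case True
  then show ?thesis
    using assms by (cases "a = 0"; cases "a = 1")
      (auto simp: nlog_nonpos nlog_pos binent_def ennreal_mult_top)
next
  case False
  then have b: "0 < b" "b < 1" using assms by auto
  have "binent a \<le> - (a * ln b) - (1 - a) * ln (1 - b)"
    using mult_ln_ge[of a b] mult_ln_ge[of "1 - a" "1 - b"] assms b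
    by (simp add: binent_def)
  then show ?thesis
    unfolding nlog_cross_entropy_eq[OF assms(1,2) b] by (rule ennreal_leI)
qed

lemma nlog_cross_entropy_self:
  assumes "0 \<le> a" "a \<le> 1"
  shows "ennreal a * nlog a + ennreal (1 - a) * nlog (1 - a) = ennreal (binent a)"
proof (cases "a = 0 \<or> a = 1")
  case True
  then show ?thesis by (auto simp: nlog_nonpos nlog_pos binent_def)
next
  case False
  then have a: "0 < a" "a < 1" using assms by auto
  then show ?thesis using nlog_cross_entropy_eq[OF assms a] by (simp only: binent_def)
qed

text \<open>Gibbs' inequality at \<open>a = 1/2\<close>, multiplied by 2, together with its equality
  case. It singles out the optimal discriminators once the two laws agree.\<close>

lemma nlog_add_ge:
  assumes "0 \<le> b" "b \<le> 1"
  shows "ennreal (2 * ln 2) \<le> nlog b + nlog (1 - b)"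
    and "b \<noteq> 1/2 \<Longrightarrow> ennreal (2 * ln 2) < nlog b + nlog (1 - b)"
proof -
  have *: "ennreal (2 * ln 2) < nlog b + nlog (1 - b)" if ne: "b \<noteq> 1/2"
  proof (cases "b = 0 \<or> b = 1")
    case True
    then show ?thesis by (auto simp: nlog_nonpos less_top[symmetric])
  next
    case False
    then have b: "0 < b" "b < 1" using assms by auto
    have "nlog b + nlog (1 - b) = ennreal (- ln b + - ln (1 - b))"
      using b by (subst ennreal_plus) (auto simp: nlog_pos)
    moreover have "2 * ln 2 < - ln b + - ln (1 - b)"
    proof -
      have "1/2 - b < 1/2 * ln (1/2) - 1/2 * ln b"
        using b ne by (intro mult_ln_gt) auto
      moreover have "1/2 - (1 - b) \<le> 1/2 * ln (1/2) - 1/2 * ln (1 - b)"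
        using b by (intro mult_ln_ge) auto
      ultimately show ?thesis by (simp add: ln_div)
    qed
    ultimately show ?thesis by (simp add: ennreal_less_iff)
  qed
  then show "b \<noteq> 1/2 \<Longrightarrow> ennreal (2 * ln 2) < nlog b + nlog (1 - b)" .
  show "ennreal (2 * ln 2) \<le> nlog b + nlog (1 - b)"
  proof (cases "b = 1/2")
    case True
    then show ?thesis
      by (simp only: nlog_half_add order_refl)
  qed (use * in auto)
qed

section \<open>Minimising the cost over discriminators\<close>

text \<open>Both laws are absolutely continuous with respect to their sum \<open>R\<close>, and
  their Radon-Nikodym derivatives add up to 1 almost everywhere. A suitable version of the first one
  is itself a discriminator.\<close>

lemma common_density:
  assumes "prob_space M" "prob_space N" and sets_N: "sets N = sets M"
  obtains R a where "finite_measure R" "sets R = sets M" "a \<in> discriminators M"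
    "M = density R (\<lambda>w. ennreal (a w))" "N = density R (\<lambda>w. ennreal (1 - a w))"
    "emeasure R (space R) = 2"
proof -
  interpret M: prob_space M by fact
  interpret N: prob_space N by fact
  have space_N: "space N = space M" using sets_N by (rule sets_eq_imp_space_eq)
  define R where "R = measure_of (space M) (sets M) (\<lambda>A. emeasure M A + emeasure N A)"
  have sets_R [simp, measurable_cong]: "sets R = sets M"
    by (simp add: R_def)
  have space_R [simp]: "space R = space M"
    by (simp add: R_def)
  have em: "emeasure R A = emeasure M A + emeasure N A" if "A \<in> sets M" for A
    unfolding R_def
  proof (rule emeasure_measure_of_sigma)
    show "sigma_algebra (space M) (sets M)" by (rule sets.sigma_algebra_axioms)
    show "positive (sets M) (\<lambda>A. emeasure M A + emeasure N A)" by (simp add: positive_def)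
    show "countably_additive (sets M) (\<lambda>A. emeasure M A + emeasure N A)"
      by (auto simp: countably_additive_def suminf_emeasure sets_N simp flip: suminf_add)
  qed fact
  have two: "emeasure R (space R) = 2"
    using em[of "space M"] M.emeasure_space_1 N.emeasure_space_1 space_N by simp
  interpret R: finite_measure R
    by standard (simp add: two[simplified])
  have acM: "absolutely_continuous R M" "absolutely_continuous R N"
    unfolding absolutely_continuous_def null_sets_def by (auto simp: em sets_N)
  define p where "p = RN_deriv R M"
  define q where "q = RN_deriv R N"
  have [measurable]: "p \<in> borel_measurable R" "q \<in> borel_measurable R"
    by (auto simp: p_def q_def)
  have dM: "density R p = M" unfolding p_def by (rule R.density_RN_deriv) (auto simp: acM)
  have dN: "density R q = N" unfolding q_def by (rule R.density_RN_deriv) (auto simp: acM sets_N)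
  \<comment> \<open>Both sides are \<open>R\<close>, since \<open>R\<close> is the sum of
    \<open>M\<close> and \<open>N\<close>; uniqueness of densities then yields
    \<open>p + q = 1\<close> almost everywhere.\<close>
  have "density R (\<lambda>w. p w + q w) = density R (\<lambda>w. 1)"
  proof (rule measure_eqI)
    fix A assume "A \<in> sets (density R (\<lambda>w. p w + q w))"
    then have A[measurable]: "A \<in> sets M" by simp
    have "emeasure (density R (\<lambda>w. p w + q w)) A = emeasure (density R p) A + emeasure (density R q) A"
      by (simp add: emeasure_density distrib_right nn_integral_add)
    also have "\<dots> = emeasure R A" by (simp add: em dM dN)
    finally show "emeasure (density R (\<lambda>w. p w + q w)) A = emeasure (density R (\<lambda>w. 1)) A"
      by (simp add: density_1)
  qed simp
  then have pq: "AE w in R. p w + q w = 1"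
    by (subst (asm) R.density_unique_iff) auto
  \<comment> \<open>Truncation at 1 changes \<open>p\<close> only on a null set, but puts the values
    into \<open>[0, 1]\<close> at every point, as membership in \<open>discriminators\<close>
    demands.\<close>
  define a where "a w = min 1 (enn2real (p w))" for w
  have a: "AE w in R. p w = ennreal (a w) \<and> q w = ennreal (1 - a w)"
    using pq
  proof eventually_elim
    case (elim w)
    then have fin: "p w < top" "q w < top"
      by (auto simp: less_top[symmetric])
    then obtain x y where xy: "p w = ennreal x" "0 \<le> x" "q w = ennreal y" "0 \<le> y"
      by (cases "p w"; cases "q w") auto
    with elim have "x + y = 1"
      by (simp flip: ennreal_plus ennreal_1)
    with xy show ?case by (simp add: a_def min_def)
  qed
  have am [measurable]: "a \<in> borel_measurable R" unfolding a_def[abs_def] by measurable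
  show ?thesis
  proof
    show "a \<in> discriminators M"
      using am by (auto simp: discriminators_def a_def)
    show "M = density R (\<lambda>w. ennreal (a w))"
      unfolding dM[symmetric] using a by (intro density_cong) auto
    show "N = density R (\<lambda>w. ennreal (1 - a w))"
      unfolding dN[symmetric] using a by (intro density_cong) auto
  qed (use two R.finite_measure_axioms in auto)
qed

text \<open>The nonnegative difference \<open>g - f\<close> has integral 0; finiteness is what
  permits the subtraction in \<open>ennreal\<close>.\<close>

lemma AE_eq_of_nn_integral_eq:
  assumes [measurable]: "f \<in> borel_measurable M" "g \<in> borel_measurable M"
    and le: "\<And>w. w \<in> space M \<Longrightarrow> f w \<le> g w"
    and eq: "(\<integral>\<^sup>+ w. g w \<partial>M) = (\<integral>\<^sup>+ w. f w \<partial>M)" and fin: "(\<integral>\<^sup>+ w. f w \<partial>M) \<noteq> \<infinity>"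
  shows "AE w in M. g w = f w"
proof -
  have finAE: "AE w in M. f w \<noteq> \<infinity>"
    using nn_integral_noteq_infinite[OF _ fin] by simp
  have "(\<integral>\<^sup>+ w. g w - f w \<partial>M) = (\<integral>\<^sup>+ w. g w \<partial>M) - (\<integral>\<^sup>+ w. f w \<partial>M)"
    using fin by (intro nn_integral_diff) (auto intro!: AE_I2 le)
  also have "\<dots> = 0" using eq fin by simp
  finally have "AE w in M. g w - f w = 0" by (subst (asm) nn_integral_0_iff_AE) auto
  with finAE AE_space show ?thesis
  proof eventually_elim
    case (elim w)
    then have "g w \<le> f w" by (auto simp: diff_eq_0_iff_ennreal)
    with le[of w] elim show ?case by auto
  qed
qed

lemma gan_cost_density:
  assumes [measurable]: "a \<in> borel_measurable R" "D \<in> borel_measurable R"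
  shows "gan_cost (density R (\<lambda>w. ennreal (a w))) (density R (\<lambda>w. ennreal (1 - a w))) D =
    (\<integral>\<^sup>+ w. ennreal (a w) * nlog (D w) + ennreal (1 - a w) * nlog (1 - D w) \<partial>R)"
  unfolding gan_cost_def
  by (subst (1 2) nn_integral_density) (auto simp: nn_integral_add)

text \<open>The witness is the density \<open>a\<close> of \<open>M\<close> with respect to
  \<open>M + N\<close>. The conclusion mentions costs only, so that no densities occur after this
  point.\<close>

theorem gan_cost_minimiser:
  assumes M: "prob_space M" and N: "prob_space N" and sets_N: "sets N = sets M"
  obtains E where "E \<in> discriminators M" "\<And>D. D \<in> discriminators M \<Longrightarrow> gan_cost M N E \<le> gan_cost M N D"
    "gan_cost M N E \<le> ennreal (2 * ln 2)" "gan_cost M N E = ennreal (2 * ln 2) \<longleftrightarrow> M = N"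
proof -
  obtain R a where R: "finite_measure R" and sets_R [measurable_cong]: "sets R = sets M" and a: "a \<in> discriminators M"
    and M_eq: "M = density R (\<lambda>w. ennreal (a w))" and N_eq: "N = density R (\<lambda>w. ennreal (1 - a w))"
    and R2: "emeasure R (space R) = 2"
    using common_density[OF assms] by metis
  interpret R: finite_measure R by fact
  have space_R: "space R = space M" using sets_R by (rule sets_eq_imp_space_eq)
  have disc: "D \<in> borel_measurable R" "\<And>w. w \<in> space R \<Longrightarrow> 0 \<le> D w \<and> D w \<le> 1"
    if "D \<in> discriminators M" for D
    using that measurable_cong_sets[OF sets_R refl] by (auto simp: discriminators_def space_R)
  note [measurable] = disc(1)[OF a]
  \<comment> \<open>The factor 2 is the total mass of \<open>R\<close>; this rewrites the bound as
    the integral of the maximal entropy.\<close>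
  have const: "(\<integral>\<^sup>+ w. ennreal (ln 2) \<partial>R) = ennreal (2 * ln 2)"
    by (simp add: R2 ennreal_mult' mult.commute)
  have cost: "gan_cost M N a = (\<integral>\<^sup>+ w. ennreal (binent (a w)) \<partial>R)"
    unfolding M_eq N_eq
    by (subst gan_cost_density) (auto intro!: nn_integral_cong nlog_cross_entropy_self dest: disc(2)[OF a])
  have le_ln2: "ennreal (binent (a w)) \<le> ennreal (ln 2)" if "w \<in> space R" for w
    using disc(2)[OF a that] by (intro ennreal_leI binent_le_ln2) auto
  show ?thesis
  proof
    show "a \<in> discriminators M" by fact
    show "gan_cost M N a \<le> gan_cost M N D" if D: "D \<in> discriminators M" for D
    proof -
      note [measurable] = disc(1)[OF D]
      have "gan_cost M N D =
        (\<integral>\<^sup>+ w. ennreal (a w) * nlog (D w) + ennreal (1 - a w) * nlog (1 - D w) \<partial>R)"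
        unfolding M_eq N_eq by (rule gan_cost_density) measurable
      moreover have "gan_cost M N a \<le> \<dots>"
        unfolding cost using disc(2)[OF a] disc(2)[OF D]
        by (intro nn_integral_mono nlog_cross_entropy_ge) auto
      ultimately show ?thesis by simp
    qed
    show "gan_cost M N a \<le> ennreal (2 * ln 2)"
      unfolding cost const[symmetric] by (intro nn_integral_mono le_ln2)
    show "gan_cost M N a = ennreal (2 * ln 2) \<longleftrightarrow> M = N"
    proof
      assume "gan_cost M N a = ennreal (2 * ln 2)"
      then have eq: "(\<integral>\<^sup>+ w. ennreal (ln 2) \<partial>R) = (\<integral>\<^sup>+ w. ennreal (binent (a w)) \<partial>R)"
        by (simp only: cost const)
      \<comment> \<open>Equal finite integrals of pointwise ordered functions force equality almost
        everywhere, and only \<open>1 / 2\<close> has entropy \<open>ln 2\<close>.\<close>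
      have "AE w in R. ennreal (ln 2) = ennreal (binent (a w))"
      proof (rule AE_eq_of_nn_integral_eq[OF _ _ le_ln2 eq])
        show "(\<integral>\<^sup>+ w. ennreal (binent (a w)) \<partial>R) \<noteq> \<infinity>"
          unfolding eq[symmetric] const by simp
      qed auto
      with AE_space have "AE w in R. a w = 1 / 2"
      proof eventually_elim
        case (elim w)
        then show ?case
          using binent_less_ln2[of "a w"] binent_nonneg[of "a w"] disc(2)[OF a, of w] by auto
      qed
      then have "AE w in R. ennreal (a w) = ennreal (1 - a w)"
        by eventually_elim simp
      then show "M = N"
        unfolding M_eq N_eq by (intro density_cong) auto
    next
      assume "M = N"
      \<comment> \<open>Conversely, uniqueness of densities gives \<open>a = 1 - a\<close> almost
        everywhere.\<close>
      then have "density R (\<lambda>w. ennreal (a w)) = density R (\<lambda>w. ennreal (1 - a w))"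
        using M_eq N_eq by simp
      then have "AE w in R. ennreal (a w) = ennreal (1 - a w)"
        by (subst (asm) R.density_unique_iff) auto
      with AE_space have "AE w in R. a w = 1 / 2"
      proof eventually_elim
        case (elim w)
        then show ?case using disc(2)[OF a, of w] by auto
      qed
      then have "AE w in R. ennreal (binent (a w)) = ennreal (ln 2)"
        by eventually_elim (simp only: binent_half)
      then show "gan_cost M N a = ennreal (2 * ln 2)"
        unfolding cost const[symmetric] by (rule nn_integral_cong_AE)
    qed
  qed
qed

text \<open>For equal laws the cost is one integral of \<open>nlog (D w) + nlog (1 - D w)\<close>
  over a probability measure, so it equals the pointwise lower bound exactly when the integrand does
  almost everywhere.\<close>

lemma gan_cost_same_eq_iff:
  assumes M: "prob_space M" and D: "D \<in> discriminators M"
  shows "gan_cost M M D = ennreal (2 * ln 2) \<longleftrightarrow> (AE w in M. D w = 1 / 2)"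
proof -
  interpret M: prob_space M by fact
  have [measurable]: "D \<in> borel_measurable M" and D01: "\<And>w. w \<in> space M \<Longrightarrow> 0 \<le> D w \<and> D w \<le> 1"
    using D by (auto simp: discriminators_def)
  have cost: "gan_cost M M D = (\<integral>\<^sup>+ w. nlog (D w) + nlog (1 - D w) \<partial>M)"
    unfolding gan_cost_def by (intro nn_integral_add[symmetric]) auto
  have const: "(\<integral>\<^sup>+ w. ennreal (2 * ln 2) \<partial>M) = ennreal (2 * ln 2)"
    by (simp add: M.emeasure_space_1)
  show ?thesis
  proof
    assume "gan_cost M M D = ennreal (2 * ln 2)"
    then have "AE w in M. nlog (D w) + nlog (1 - D w) = ennreal (2 * ln 2)"
      using D01 by (intro AE_eq_of_nn_integral_eq) (auto simp only: cost const intro!: nlog_add_ge(1), auto)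
    with AE_space show "AE w in M. D w = 1 / 2"
    proof eventually_elim
      case (elim w)
      then show ?case using D01[of w] nlog_add_ge(2)[of "D w"] by auto
    qed
  next
    assume "AE w in M. D w = 1 / 2"
    then have "AE w in M. nlog (D w) + nlog (1 - D w) = ennreal (2 * ln 2)"
      by eventually_elim (simp only: nlog_half_add)
    then show "gan_cost M M D = ennreal (2 * ln 2)"
      unfolding cost by (rule trans[OF nn_integral_cong_AE const])
  qed
qed

lemma discriminators_cong: "sets M = sets N \<Longrightarrow> discriminators M = discriminators N"
  unfolding discriminators_def using sets_eq_imp_space_eq[of M N] measurable_cong_sets[of M N borel borel]
  by auto

section \<open>Value of the game between two laws\<close>

text \<open>Stated for an abstract objective \<open>L\<close> on a space \<open>W\<close>, so that
  the games for \<open>(x, z)\<close> and for \<open>(x, y)\<close> are both instances. Negation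
  turns the minimal cost into the supremum of the objective.\<close>

lemma gan_value:
  assumes M: "prob_space M" and N: "prob_space N" and sets: "sets M = sets W" "sets N = sets W"
    and L: "\<And>D. D \<in> discriminators W \<Longrightarrow> L D = - enn2ereal (gan_cost M N D)"
  shows "\<exists>D. is_arg_max L (\<lambda>D. D \<in> discriminators W) D"
    and "ereal (- (2 * ln 2)) \<le> (SUP D \<in> discriminators W. L D)"
    and "(SUP D \<in> discriminators W. L D) = ereal (- (2 * ln 2)) \<longleftrightarrow> M = N"
    and "M = N \<Longrightarrow> D \<in> discriminators W \<Longrightarrow>
      is_arg_max L (\<lambda>D. D \<in> discriminators W) D \<longleftrightarrow> (AE w in M. D w = 1 / 2)"
proof -
  have disc: "discriminators M = discriminators W" using sets(1) by (rule discriminators_cong)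
  obtain E where E: "E \<in> discriminators W" "\<And>D. D \<in> discriminators W \<Longrightarrow> gan_cost M N E \<le> gan_cost M N D"
    "gan_cost M N E \<le> ennreal (2 * ln 2)" "gan_cost M N E = ennreal (2 * ln 2) \<longleftrightarrow> M = N"
    using gan_cost_minimiser[OF M N] sets unfolding disc by metis
  have L_le: "L D \<le> L E" if "D \<in> discriminators W" for D
    using E(2)[OF that] by (simp add: L E(1) that less_eq_ennreal.rep_eq)
  show "\<exists>D. is_arg_max L (\<lambda>D. D \<in> discriminators W) D"
    using E(1) L_le by (auto simp: is_arg_max_linorder intro!: exI[of _ E])
  have SUP: "(SUP D \<in> discriminators W. L D) = - enn2ereal (gan_cost M N E)"
    unfolding L[OF E(1), symmetric] using E(1) L_le by (intro antisym SUP_least SUP_upper)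
  have ln2: "enn2ereal (ennreal (2 * ln 2)) = ereal (2 * ln 2)" by (simp add: enn2ereal_ennreal)
  show "ereal (- (2 * ln 2)) \<le> (SUP D \<in> discriminators W. L D)"
    using E(3) unfolding SUP less_eq_ennreal.rep_eq ln2 uminus_ereal.simps(1)[symmetric] ereal_minus_le_minus .
  show "(SUP D \<in> discriminators W. L D) = ereal (- (2 * ln 2)) \<longleftrightarrow> M = N"
    unfolding SUP E(4)[symmetric] uminus_ereal.simps(1)[symmetric] ereal_uminus_eq_iff ln2[symmetric]
      enn2ereal_inject ..
  assume MN: "M = N" and D: "D \<in> discriminators W"
  \<comment> \<open>A discriminator is optimal iff it shares the value of \<open>E\<close>, whose
    cost is \<open>2 * ln 2\<close> when the laws agree.\<close>
  have "is_arg_max L (\<lambda>D. D \<in> discriminators W) D \<longleftrightarrow> L D = L E"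
    using D E(1) L_le by (auto simp: is_arg_max_linorder intro: antisym)
  also have "\<dots> \<longleftrightarrow> gan_cost M M D = ennreal (2 * ln 2)"
  proof -
    have "gan_cost M N E = ennreal (2 * ln 2)" using E(4) MN by simp
    then show ?thesis
      unfolding L[OF D] L[OF E(1)] ereal_uminus_eq_iff enn2ereal_inject by (simp only: MN)
  qed
  also have "\<dots> \<longleftrightarrow> (AE w in M. D w = 1 / 2)"
    using M D disc by (intro gan_cost_same_eq_iff) auto
  finally show "is_arg_max L (\<lambda>D. D \<in> discriminators W) D \<longleftrightarrow> (AE w in M. D w = 1 / 2)" .
qed

text \<open>A lower bound that is attained somewhere is the minimum, so the minimisers are the
  points that attain it.\<close>

lemma is_arg_min_iff_attains:
  fixes f :: "'a \<Rightarrow> 'b :: linorder"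
  assumes "\<And>x. S x \<Longrightarrow> c \<le> f x" "S y" "f y = c" "S x"
  shows "is_arg_min f S x \<longleftrightarrow> f x = c"
  using assms unfolding is_arg_min_linorder by (metis antisym)

section \<open>Coding standard Borel spaces by real numbers\<close>

text \<open>Packs a bit sequence into one real number. In base 2 a tail of ones and a carry would
  give the same number; base 4 avoids this.\<close>

definition quaternary_sum :: "(nat \<Rightarrow> bool) \<Rightarrow> real" where
  "quaternary_sum b = (\<Sum>k. of_bool (b k) * (1 / 4) ^ Suc k)"

lemma quaternary_sum_summable: "summable (\<lambda>k. of_bool (b k) * (1 / 4 :: real) ^ Suc k)"
  by (rule summable_comparison_test[of _ "\<lambda>k. (1 / 4) ^ Suc k"])
    (auto intro!: exI[of _ 0] summable_Suc_iff[THEN iffD2] summable_geometric simp del: power_Suc)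

lemma quaternary_sum_bounds: "0 \<le> quaternary_sum b" "quaternary_sum b \<le> 1 / 3"
proof -
  show "0 \<le> quaternary_sum b"
    unfolding quaternary_sum_def by (intro suminf_nonneg quaternary_sum_summable) simp
  have sums: "(\<lambda>k. (1 / 4) ^ Suc k :: real) sums (1 / 4 * (1 / (1 - 1 / 4)))"
    unfolding power_Suc by (intro sums_mult geometric_sums) simp
  have "quaternary_sum b \<le> (\<Sum>k. (1 / 4) ^ Suc k)"
    unfolding quaternary_sum_def
    by (intro suminf_le quaternary_sum_summable sums_summable[OF sums]) auto
  also have "\<dots> = 1 / 3" using sums_unique[OF sums] by simp
  finally show "quaternary_sum b \<le> 1 / 3" .
qed

text \<open>Splits off the leading bit; this recursion drives the induction that recovers the
  digits.\<close>

lemma quaternary_sum_Suc: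
  "quaternary_sum b = (of_bool (b 0) + quaternary_sum (\<lambda>k. b (Suc k))) / 4"
proof -
  have "quaternary_sum b = of_bool (b 0) / 4 + (\<Sum>k. of_bool (b (Suc k)) * (1 / 4) ^ Suc (Suc k))"
    unfolding quaternary_sum_def
    using suminf_split_head[OF quaternary_sum_summable[of b]] by simp
  also have "(\<Sum>k. of_bool (b (Suc k)) * (1 / 4 :: real) ^ Suc (Suc k)) =
    1 / 4 * quaternary_sum (\<lambda>k. b (Suc k))"
    unfolding quaternary_sum_def
    by (subst suminf_mult[OF quaternary_sum_summable, symmetric]) (simp add: ac_simps)
  finally show ?thesis by simp
qed

text \<open>Digits 0 and 1 in base 4 keep the tail in \<open>[0, 1/3]\<close>, so that no carry disturbs the digits.\<close>

definition quaternary_digit :: "nat \<Rightarrow> real \<Rightarrow> bool" where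
  "quaternary_digit k t = odd \<lfloor>4 ^ Suc k * t\<rfloor>"

lemma quaternary_digit_measurable [measurable]: "Measurable.pred borel (quaternary_digit k)"
  unfolding quaternary_digit_def[abs_def] by measurable

lemma quaternary_digit_sum: "quaternary_digit k (quaternary_sum b) = b k"
proof (induction k arbitrary: b)
  case 0
  let ?q = "quaternary_sum (\<lambda>k. b (Suc k))"
  have "4 ^ Suc 0 * quaternary_sum b = of_int (of_bool (b 0)) + ?q"
    by (subst quaternary_sum_Suc) simp
  moreover have "\<lfloor>?q\<rfloor> = 0"
    using quaternary_sum_bounds[of "\<lambda>k. b (Suc k)"] by (intro floor_eq_iff[THEN iffD2]) auto
  ultimately have "\<lfloor>4 ^ Suc 0 * quaternary_sum b\<rfloor> = of_bool (b 0)"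
    by (simp only: int_add_floor[symmetric] add_0_right)
  then show ?case by (simp add: quaternary_digit_def)
next
  case (Suc k)
  let ?q = "quaternary_sum (\<lambda>k. b (Suc k))"
  \<comment> \<open>The leading bit contributes a multiple of \<open>4 ^ Suc k\<close>, an even
    integer, so it does not affect the parity of the floor.\<close>
  have "4 ^ Suc (Suc k) * quaternary_sum b = of_int (4 ^ Suc k * of_bool (b 0)) + 4 ^ Suc k * ?q"
    by (subst quaternary_sum_Suc) (simp add: field_simps)
  then have "\<lfloor>4 ^ Suc (Suc k) * quaternary_sum b\<rfloor> = 4 ^ Suc k * of_bool (b 0) + \<lfloor>4 ^ Suc k * ?q\<rfloor>"
    by (simp only: int_add_floor[symmetric])
  then have "quaternary_digit (Suc k) (quaternary_sum b) = quaternary_digit k ?q"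
    by (simp add: quaternary_digit_def)
  with Suc show ?case by simp
qed

text \<open>A point is coded by the indices of the first points of a dense sequence within \<open>2\<^sup>-\<^sup>m\<close> of it.\<close>

lemma standard_borel_real_coding:
  assumes X: "standard_borel X" and ne: "space X \<noteq> {}"
  obtains f r where "f \<in> X \<rightarrow>\<^sub>M borel" "\<And>x. f x \<in> {0..1::real}" "r \<in> borel \<rightarrow>\<^sub>M X"
    "\<And>x. x \<in> space X \<Longrightarrow> r (f x) = x"
proof -
  obtain T where T: "completely_metrizable_space T" "separable_space T" "topspace T = space X"
    "sets X = sigma_sets (space X) {U. openin T U}"
    using X unfolding standard_borel_def by blast
  obtain M d where "Metric_space M d" and compl: "Metric_space.mcomplete M d"
    and T_eq: "T = Metric_space.mtopology M d"
    using T(1) unfolding completely_metrizable_space_def by blast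
  interpret Metric_space M d by fact
  have space_X: "space X = M" using T(3) by (simp add: T_eq)
  have sets_X: "sets X = sigma_sets M {U. openin mtopology U}"
    using T(4) by (simp add: T_eq space_X)
  obtain C where C: "countable C" "C \<subseteq> M" "mtopology closure_of C = M"
    using T(2) unfolding separable_space_def T_eq by auto
  have "C \<noteq> {}" using C(3) ne space_X by auto
  define c where "c = from_nat_into C"
  have range_c: "range c = C" unfolding c_def using C(1) \<open>C \<noteq> {}\<close> by (rule range_from_nat_into[rotated])
  have c_M: "c n \<in> M" for n using range_c C(2) by auto
  have dense: "\<exists>n. d x (c n) < e" if x: "x \<in> M" and e: "0 < e" for x e
  proof -
    have "x \<in> mtopology closure_of C" using x C(3) by simp
    then obtain y where "y \<in> C" "y \<in> mball x e"
      using e unfolding metric_closure_of by auto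
    then show ?thesis using range_c by (auto simp: in_mball)
  qed
  have open_X: "U \<in> sets X" if "openin mtopology U" for U
    unfolding sets_X using that by auto
  have near [measurable]: "Measurable.pred X (\<lambda>x. d x (c n) < e)" for n e
  proof -
    have "{x \<in> space X. d x (c n) < e} = mball (c n) e"
      using c_M by (auto simp: space_X in_mball commute)
    then show ?thesis unfolding pred_def by (simp add: open_X)
  qed
  \<comment> \<open>One bit for each pair \<open>(m, n)\<close>: whether the dense point
    \<open>c n\<close> lies within \<open>(1 / 2) ^ m\<close> of \<open>x\<close>.\<close>
  define b where "b x k = (case prod_decode k of (m, n) \<Rightarrow> d x (c n) < (1 / 2) ^ m)" for x k
  have b_meas [measurable]: "Measurable.pred X (\<lambda>x. b x k)" for k
    unfolding b_def by (cases "prod_decode k") simp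
  define f where "f x = quaternary_sum (b x)" for x
  have f_meas: "f \<in> X \<rightarrow>\<^sub>M borel"
    unfolding f_def quaternary_sum_def by measurable
  \<comment> \<open>Decoding: read the bits of \<open>t\<close> and take the first dense point
    marked as close at scale \<open>m\<close>.\<close>
  define N where "N m t = (LEAST n. quaternary_digit (prod_encode (m, n)) t)" for m t
  have N_meas [measurable]: "N m \<in> borel \<rightarrow>\<^sub>M count_space UNIV" for m
    unfolding N_def by measurable
  define s where "s m t = c (N m t)" for m t
  have s_M: "s m t \<in> M" for m t by (simp add: s_def c_M)
  \<comment> \<open>Since \<open>s m\<close> factors through the discrete index \<open>N m\<close>,
    any function of it is measurable.\<close>
  have s_meas: "(\<lambda>t. h (s m t)) \<in> borel \<rightarrow>\<^sub>M L" if "\<And>n. h (c n) \<in> space L" for h m and L :: "'b measure"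
  proof -
    have "(\<lambda>n. h (c n)) \<in> count_space UNIV \<rightarrow>\<^sub>M L" using that by simp
    from measurable_compose[OF N_meas this] show ?thesis by (simp add: s_def)
  qed
  \<comment> \<open>An explicit Cauchy rate. As a countable conjunction it is a measurable condition
    on \<open>t\<close>, and it holds at every code \<open>f x\<close>.\<close>
  define good where "good t \<longleftrightarrow> (\<forall>m k. d (s m t) (s (m + k) t) \<le> 2 * (1 / 2) ^ m)" for t
  have good_meas [measurable]: "Measurable.pred borel good"
  proof -
    have [measurable]: "Measurable.pred borel (\<lambda>t. d (s m t) (s (m + k) t) \<le> 2 * (1 / 2) ^ m)" for m k
    proof -
      have "(\<lambda>t. (N m t, N (m + k) t)) \<in> borel \<rightarrow>\<^sub>M count_space UNIV \<Otimes>\<^sub>M count_space UNIV"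
        by measurable
      then have "(\<lambda>t. (N m t, N (m + k) t)) \<in> borel \<rightarrow>\<^sub>M count_space UNIV"
        by (simp add: pair_measure_countable)
      from measurable_compose[OF this, of "\<lambda>(i, j). d (c i) (c j) \<le> 2 * (1 / 2) ^ m" "count_space UNIV"]
      show ?thesis by (simp add: s_def)
    qed
    show ?thesis unfolding good_def[abs_def] by measurable
  qed
  \<comment> \<open>The limit exists by completeness whenever \<open>t\<close> is good; the default
    \<open>c 0\<close> keeps \<open>r\<close> inside the space for all other reals.\<close>
  define r where "r t = (if good t then SOME x. limitin mtopology (\<lambda>m. s m t) x sequentially else c 0)" for t
  have r_lim: "limitin mtopology (\<lambda>m. s m t) (r t) sequentially" if "good t" for t
  proof -
    have "MCauchy (\<lambda>m. s m t)"
      unfolding MCauchy_def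
    proof (intro conjI allI impI)
      fix e :: real assume "0 < e"
      then obtain k where k: "(1 / 2) ^ k < e / 4"
        using real_arch_pow_inv[of "e / 4" "1 / 2"] by auto
      show "\<exists>k. \<forall>n n'. k \<le> n \<longrightarrow> k \<le> n' \<longrightarrow> d (s n t) (s n' t) < e"
      proof (intro exI allI impI)
        fix n n' assume "k \<le> n" "k \<le> n'"
        then have "d (s k t) (s n t) \<le> 2 * (1 / 2) ^ k" "d (s k t) (s n' t) \<le> 2 * (1 / 2) ^ k"
          using that unfolding good_def by (metis le_add_diff_inverse)+
        then show "d (s n t) (s n' t) < e"
          using triangle[of "s n t" "s k t" "s n' t"] s_M k commute[of "s n t" "s k t"] by simp
      qed
    qed (use s_M in auto)
    then have "\<exists>x. limitin mtopology (\<lambda>m. s m t) x sequentially"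
      using compl unfolding mcomplete_def by blast
    from someI_ex[OF this] show ?thesis using that by (simp add: r_def)
  qed
  have r_M: "r t \<in> M" for t
    using r_lim[of t] c_M by (cases "good t") (auto simp: r_def dest: limitin_mspace)
  \<comment> \<open>The distance to \<open>r t\<close> is a pointwise limit of measurable functions,
    where the constant \<open>d a (c 0)\<close> is used off the good set.\<close>
  have dist_meas: "(\<lambda>t. d a (r t)) \<in> borel_measurable borel" if a: "a \<in> M" for a
  proof (rule borel_measurable_LIMSEQ_real)
    define h where "h m t = (if good t then d a (s m t) else d a (c 0))" for m t
    have [measurable]: "(\<lambda>t. d a (s m t)) \<in> borel_measurable borel" for m
      by (rule s_meas) simp
    show "h m \<in> borel_measurable borel" for m
      unfolding h_def[abs_def] by measurable
    show "(\<lambda>m. h m t) \<longlonglongrightarrow> d a (r t)" for t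
    proof (cases "good t")
      case True
      have "(\<lambda>m. d (s m t) (r t)) \<longlonglongrightarrow> 0"
        using r_lim[OF True] by (simp add: limitin_metric_dist_null)
      moreover have "\<bar>d a (s m t) - d a (r t)\<bar> \<le> d (s m t) (r t)" for m
        using triangle[OF a s_M[of m t] r_M[of t]] triangle[OF a r_M[of t] s_M[of m t]]
          commute[of "r t" "s m t"] by linarith
      ultimately have "(\<lambda>m. d a (s m t) - d a (r t)) \<longlonglongrightarrow> 0"
        by (auto intro: Lim_null_comparison[OF always_eventually, of "\<lambda>m. d a (s m t) - d a (r t)" "\<lambda>m. d (s m t) (r t)"])
      then show ?thesis using True by (simp add: h_def LIM_zero_iff)
    qed (simp add: h_def r_def)
  qed
  have r_meas: "r \<in> borel \<rightarrow>\<^sub>M X"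
  proof (rule measurable_sigma_sets[OF sets_X])
    show "{U. openin mtopology U} \<subseteq> Pow M" using openin_subset[of mtopology] by auto
    show "r \<in> space borel \<rightarrow> M" using r_M by simp
    fix U assume "U \<in> {U. openin mtopology U}"
    then have U: "openin mtopology U" by simp
    \<comment> \<open>Indices of the balls around dense points with radius a power of
      \<open>1/2\<close> that lie inside \<open>U\<close>. There are countably many, they exhaust
      \<open>U\<close>, and their preimages are controlled by \<open>dist_meas\<close>.\<close>
    define I where "I = {p. mball (c (fst p)) ((1 / 2) ^ snd p) \<subseteq> U}"
    have "x \<in> (\<Union>p\<in>I. mball (c (fst p)) ((1 / 2) ^ snd p))" if xU: "x \<in> U" for x
    proof -
      have "x \<in> M" using U xU openin_subset by fastforce
      obtain e where e: "0 < e" "mball x e \<subseteq> U"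
        using U xU unfolding openin_mtopology by blast
      obtain m where m: "(1 / 2) ^ m < e / 2"
        using real_arch_pow_inv[of "e / 2" "1 / 2"] e(1) by auto
      obtain n where n: "d x (c n) < (1 / 2) ^ m"
        using dense[OF \<open>x \<in> M\<close>, of "(1 / 2) ^ m"] by auto
      have "mball (c n) ((1 / 2) ^ m) \<subseteq> mball x e"
      proof
        fix y assume y: "y \<in> mball (c n) ((1 / 2) ^ m)"
        then have "d x y \<le> d x (c n) + d (c n) y"
          using \<open>x \<in> M\<close> c_M by (intro triangle) auto
        then show "y \<in> mball x e" using y n m \<open>x \<in> M\<close> by auto
      qed
      moreover have "x \<in> mball (c n) ((1 / 2) ^ m)"
        using n \<open>x \<in> M\<close> c_M by (simp add: commute)
      ultimately show ?thesis using e(2) unfolding I_def by (intro UN_I[of "(n, m)"]) auto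
    qed
    then have "U = (\<Union>p\<in>I. mball (c (fst p)) ((1 / 2) ^ snd p))"
      unfolding I_def by blast
    then have "r -` U \<inter> space borel = (\<Union>p\<in>I. {t. d (c (fst p)) (r t) < (1 / 2) ^ snd p})"
      using r_M c_M by (auto simp: set_eq_iff)
    also have "\<dots> \<in> sets borel"
    proof (rule sets.countable_UN'')
      show "countable I" by simp
      fix p assume "p \<in> I"
      have [measurable]: "(\<lambda>t. d (c n) (r t)) \<in> borel_measurable borel" for n
        by (rule dist_meas) (rule c_M)
      show "{t. d (c (fst p)) (r t) < (1 / 2) ^ snd p} \<in> sets borel"
        by measurable
    qed
    finally show "r -` U \<inter> space borel \<in> sets borel" .
  qed
  have r_f: "r (f x) = x" if "x \<in> space X" for x
  proof -
    have x: "x \<in> M" using that space_X by simp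
    \<comment> \<open>The digits of \<open>f x\<close> are the bits of \<open>x\<close>, so decoding
      finds points \<open>s m (f x)\<close> within \<open>(1 / 2) ^ m\<close> of \<open>x\<close>.
      Hence they converge to \<open>x\<close>, and uniqueness of limits gives
      \<open>r (f x) = x\<close>.\<close>
    have "N m (f x) = (LEAST n. d x (c n) < (1 / 2) ^ m)" for m
      by (simp add: N_def f_def quaternary_digit_sum b_def)
    then have close: "d x (s m (f x)) < (1 / 2) ^ m" for m
      unfolding s_def using LeastI_ex[OF dense[OF x, of "(1 / 2) ^ m"]] by simp
    have "good (f x)"
      unfolding good_def
    proof (intro allI)
      fix m k
      have "d (s m (f x)) (s (m + k) (f x)) \<le> d x (s m (f x)) + d x (s (m + k) (f x))"
        using triangle[OF s_M x s_M] commute by metis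
      also have "\<dots> \<le> (1 / 2) ^ m + (1 / 2) ^ (m + k)"
        using close[of m] close[of "m + k"] by simp
      \<comment> \<open>The two distances through \<open>x\<close> add up to at most
        \<open>2 * (1 / 2) ^ m\<close>, the constant chosen in \<open>good\<close>.\<close>
      also have "(1 / 2 :: real) ^ (m + k) \<le> (1 / 2) ^ m" by (intro power_decreasing) auto
      finally show "d (s m (f x)) (s (m + k) (f x)) \<le> 2 * (1 / 2) ^ m" by simp
    qed
    from r_lim[OF this] have lim: "limitin mtopology (\<lambda>m. s m (f x)) (r (f x)) sequentially" .
    have "(\<lambda>m. d (s m (f x)) x) \<longlonglongrightarrow> 0"
    proof (rule Lim_null_comparison)
      show "\<forall>\<^sub>F m in sequentially. norm (d (s m (f x)) x) \<le> (1 / 2) ^ m"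
        using close by (intro always_eventually allI) (simp add: commute less_imp_le)
      show "(\<lambda>m. (1 / 2 :: real) ^ m) \<longlonglongrightarrow> 0" by (intro LIMSEQ_power_zero) simp
    qed
    then have "limitin mtopology (\<lambda>m. s m (f x)) x sequentially"
      using x s_M by (simp add: limitin_metric_dist_null)
    with lim show ?thesis
      using limitin_metric_unique trivial_limit_sequentially by blast
  qed
  have "f x \<in> {0..1}" for x
    using quaternary_sum_bounds[of "b x"] by (auto simp: f_def)
  with f_meas r_meas r_f show ?thesis using that by blast
qed

section \<open>Disintegration\<close>

text \<open>Apply the hypothesis to the set where \<open>g < f\<close>. There the integrals of
  \<open>f\<close> and \<open>g\<close> coincide and are finite, so \<open>f = g\<close> almost
  everywhere on it and the set is null.\<close>

lemma AE_le_of_set_nn_integral_le: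
  fixes f g :: "'a \<Rightarrow> ennreal"
  assumes [measurable]: "f \<in> borel_measurable M" "g \<in> borel_measurable M"
    and le: "\<And>A. A \<in> sets M \<Longrightarrow> (\<integral>\<^sup>+ w \<in> A. f w \<partial>M) \<le> (\<integral>\<^sup>+ w \<in> A. g w \<partial>M)"
    and fin: "(\<integral>\<^sup>+ w. g w \<partial>M) \<noteq> \<infinity>"
  shows "AE w in M. f w \<le> g w"
proof -
  let ?A = "{w \<in> space M. g w < f w}"
  have A [measurable]: "?A \<in> sets M" by measurable
  have mono: "g w * indicator ?A w \<le> f w * indicator ?A w" for w
    by (auto simp: indicator_def)
  have "(\<integral>\<^sup>+ w \<in> ?A. f w \<partial>M) = (\<integral>\<^sup>+ w \<in> ?A. g w \<partial>M)"
    by (rule antisym[OF le[OF A]]) (intro nn_integral_mono mono)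
  moreover have "(\<integral>\<^sup>+ w \<in> ?A. g w \<partial>M) \<le> (\<integral>\<^sup>+ w. g w \<partial>M)"
    by (intro nn_integral_mono) (auto simp: indicator_def)
  then have "(\<integral>\<^sup>+ w \<in> ?A. g w \<partial>M) \<noteq> \<infinity>"
    using fin by (auto simp: top_unique)
  ultimately have "AE w in M. f w * indicator ?A w = g w * indicator ?A w"
    using mono by (intro AE_eq_of_nn_integral_eq) measurable
  with AE_space show ?thesis
  proof eventually_elim
    case (elim w)
    then show ?case by (cases "g w < f w") auto
  qed
qed

section \<open>Conditional tail functions and the quantile transform\<close>

definition unit_uniform :: "real measure" where
  "unit_uniform = uniform_measure lborel {0..1}"

lemma sets_unit_uniform [simp, measurable_cong]: "sets unit_uniform = sets borel"
  by (simp add: unit_uniform_def)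

lemma space_unit_uniform [simp]: "space unit_uniform = UNIV"
  by (simp add: unit_uniform_def)

lemma prob_space_unit_uniform: "prob_space unit_uniform"
  unfolding unit_uniform_def by (rule prob_space_uniform_measure) auto

text \<open>The set contains all negative \<open>u\<close>, for which \<open>ennreal u = 0\<close>,
  but these carry no mass.\<close>

lemma emeasure_unit_uniform_le:
  assumes "g \<le> 1"
  shows "emeasure unit_uniform {u. ennreal u \<le> g} = g"
proof -
  obtain c where c: "g = ennreal c" "0 \<le> c" "c \<le> 1"
    using assms by (cases g) (auto simp: top_unique)
  have "{0..1} \<inter> {u. ennreal u \<le> g} = {0..c}"
    using c by (auto simp: ennreal_le_iff)
  moreover have "{u. ennreal u \<le> g} \<in> sets borel" by measurable
  ultimately show ?thesis
    using c by (simp add: unit_uniform_def divide_ennreal_def)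
qed

text \<open>Supplies rationals decreasing to a real threshold \<open>s\<close>, so that the tail
  beyond \<open>s\<close> is an increasing union of tails beyond rational points.\<close>

lemma decreasing_rat_seq:
  fixes s :: real
  assumes "s < 1"
  obtains q :: "nat \<Rightarrow> rat" where "decseq q" "\<And>n. s < of_rat (q n)" "\<And>n. of_rat (q n) < (1 :: real)"
    "(\<lambda>n. of_rat (q n) :: real) \<longlonglongrightarrow> s"
proof -
  have ex: "\<exists>q. s < of_rat q \<and> of_rat q < t" if "s < t" for t
    using of_rat_dense[OF that] by blast
  have "\<exists>q :: nat \<Rightarrow> rat. \<forall>n. (s < of_rat (q n) \<and> of_rat (q n) < (1 :: real) \<and> of_rat (q n) < s + 1 / Suc n)
    \<and> q (Suc n) \<le> q n"
  proof (rule dependent_nat_choice)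
    show "\<exists>q. s < of_rat q \<and> of_rat q < (1 :: real) \<and> of_rat q < s + 1 / Suc 0"
      using ex[of "min 1 (s + 1)"] assms by auto
    fix p n assume "s < of_rat p \<and> of_rat p < (1 :: real) \<and> of_rat p < s + 1 / Suc n"
    then obtain q where "s < of_rat q" "of_rat q < min (of_rat p) (s + 1 / Suc (Suc n))" "of_rat p < (1::real)"
      using ex[of "min (of_rat p) (s + 1 / Suc (Suc n))"] by auto
    then show "\<exists>q. (s < of_rat q \<and> of_rat q < (1 :: real) \<and> of_rat q < s + 1 / Suc (Suc n)) \<and> q \<le> p"
      by (intro exI[of _ q]) (auto simp: of_rat_less)
  qed
  then obtain q :: "nat \<Rightarrow> rat" where q: "\<And>n. s < of_rat (q n)" "\<And>n. of_rat (q n) < (1 :: real)"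
    "\<And>n. of_rat (q n) < s + 1 / Suc n" "\<And>n. q (Suc n) \<le> q n"
    by blast
  show ?thesis
  proof
    show "decseq q" using q(4) by (rule decseq_SucI)
    have "(\<lambda>n. s + 1 / Suc n) \<longlonglongrightarrow> s + 0"
      by (intro tendsto_add tendsto_const LIMSEQ_Suc lim_const_over_n)
    then have lim: "(\<lambda>n. s + 1 / Suc n) \<longlonglongrightarrow> s" by simp
    show "(\<lambda>n. of_rat (q n) :: real) \<longlonglongrightarrow> s"
    proof (rule tendsto_sandwich[OF _ _ tendsto_const lim])
      show "\<forall>\<^sub>F n in sequentially. s \<le> of_rat (q n)"
        using q(1) by (intro always_eventually allI less_imp_le)
      show "\<forall>\<^sub>F n in sequentially. of_rat (q n) \<le> s + 1 / real (Suc n)"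
        using q(3) by (intro always_eventually allI less_imp_le)
    qed
  qed (use q in auto)
qed

text \<open>\<open>G q y\<close> is a version of the conditional probability that the first
  coordinate exceeds \<open>q\<close>, given that the second is \<open>y\<close>. With rational
  \<open>q\<close> only, the countably many exceptional null sets can be merged into one.\<close>

lemma conditional_tail_densities:
  fixes Q :: "(real \<times> 'y) measure"
  assumes "prob_space Q" and sets_Q [measurable_cong]: "sets Q = sets (borel \<Otimes>\<^sub>M Y)"
  obtains G :: "rat \<Rightarrow> 'y \<Rightarrow> ennreal"
  where "\<And>q. G q \<in> borel_measurable Y"
    "\<And>q B. B \<in> sets Y \<Longrightarrow> (\<integral>\<^sup>+ y \<in> B. G q y \<partial>distr Q Y snd) = emeasure Q ({of_rat q<..} \<times> B)"
    "AE y in distr Q Y snd. (\<forall>p q. p \<le> q \<longrightarrow> G q y \<le> G p y) \<and> (\<forall>q. G q y \<le> 1)"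
proof -
  interpret Q: prob_space Q by fact
  define \<mu> where "\<mu> = distr Q Y snd"
  have sets_\<mu> [simp, measurable_cong]: "sets \<mu> = sets Y" by (simp add: \<mu>_def)
  have space_\<mu> [simp]: "space \<mu> = space Y" by (simp add: \<mu>_def)
  have space_Q: "space Q = UNIV \<times> space Y"
    using sets_eq_imp_space_eq[OF sets_Q] by (simp add: space_pair_measure)
  interpret \<mu>: prob_space \<mu> unfolding \<mu>_def by (rule Q.prob_space_distr) measurable
  \<comment> \<open>The second marginal of \<open>Q\<close> restricted to the event that the first
    coordinate exceeds \<open>q\<close>. It is dominated by \<open>\<mu>\<close>, and its density is
    taken as \<open>G q\<close>.\<close>
  define \<nu> where "\<nu> q = distr (density Q (indicator ({of_rat q<..} \<times> space Y))) Y snd" for q :: rat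
  have \<nu>: "emeasure (\<nu> q) B = emeasure Q ({of_rat q<..} \<times> B)" if [measurable]: "B \<in> sets Y" for q B
  proof -
    have "snd -` B \<inter> space Q = UNIV \<times> B"
      using sets.sets_into_space[OF that] by (auto simp: space_Q)
    moreover have "({of_rat q :: real<..} \<times> space Y) \<inter> (UNIV \<times> B) = {of_rat q<..} \<times> B"
      using sets.sets_into_space[OF that] by auto
    ultimately show ?thesis
      by (simp add: \<nu>_def emeasure_distr emeasure_density flip: indicator_inter_arith)
  qed
  have \<mu>_eq: "emeasure \<mu> B = emeasure Q (UNIV \<times> B)" if "B \<in> sets Y" for B
  proof -
    have "snd -` B \<inter> space Q = UNIV \<times> B"
      using sets.sets_into_space[OF that] by (auto simp: space_Q)
    then show ?thesis using that by (simp add: \<mu>_def emeasure_distr)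
  qed
  have [measurable]: "\<And>B. B \<in> sets Y \<Longrightarrow> UNIV \<times> B \<in> sets Q" by simp
  have ac: "absolutely_continuous \<mu> (\<nu> q)" for q
    unfolding absolutely_continuous_def
  proof
    fix B assume "B \<in> null_sets \<mu>"
    then have "B \<in> sets Y" "emeasure \<mu> B = 0" by auto
    with \<mu>_eq[of B] have B: "B \<in> sets Y" "emeasure Q (UNIV \<times> B) = 0" by auto
    have "emeasure Q ({of_rat q<..} \<times> B) \<le> emeasure Q (UNIV \<times> B)"
      using B by (intro emeasure_mono) auto
    then show "B \<in> null_sets (\<nu> q)" using B by (auto simp: null_sets_def \<nu>) (simp add: \<nu>_def)
  qed
  define G where "G q = RN_deriv \<mu> (\<nu> q)" for q
  have G_meas [measurable]: "G q \<in> borel_measurable Y" for q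
    using borel_measurable_RN_deriv[of \<mu> "\<nu> q"] by (simp add: G_def)
  have "density \<mu> (G q) = \<nu> q" for q
    unfolding G_def by (rule \<mu>.density_RN_deriv[OF ac]) (simp add: \<nu>_def)
  then have G: "(\<integral>\<^sup>+ y \<in> B. G q y \<partial>\<mu>) = emeasure Q ({of_rat q<..} \<times> B)" if "B \<in> sets Y" for q B
    using that by (simp add: \<nu>[symmetric] emeasure_density[symmetric])
  have G_fin: "(\<integral>\<^sup>+ y. G q y \<partial>\<mu>) \<noteq> \<infinity>" for q
  proof -
    have "(\<integral>\<^sup>+ y. G q y \<partial>\<mu>) = (\<integral>\<^sup>+ y \<in> space Y. G q y \<partial>\<mu>)"
      by (intro nn_integral_cong) auto
    then show ?thesis by (simp add: G)
  qed
  \<comment> \<open>Integrated over any \<open>B\<close>, the inequality compares the masses of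
    nested sets, so it holds almost everywhere for the densities.\<close>
  have "AE y in \<mu>. G q y \<le> G p y" if "p \<le> q" for p q
  proof (rule AE_le_of_set_nn_integral_le[OF _ _ _ G_fin])
    have le: "(of_rat p :: real) \<le> of_rat q" using that by (simp add: of_rat_less_eq)
    fix B assume "B \<in> sets \<mu>"
    then show "(\<integral>\<^sup>+ y \<in> B. G q y \<partial>\<mu>) \<le> (\<integral>\<^sup>+ y \<in> B. G p y \<partial>\<mu>)"
      using le_less_trans[OF le] by (simp add: G) (intro emeasure_mono, auto)
  qed auto
  moreover have "AE y in \<mu>. G q y \<le> 1" for q
  proof (rule AE_le_of_set_nn_integral_le)
    fix B assume "B \<in> sets \<mu>"
    then show "(\<integral>\<^sup>+ y \<in> B. G q y \<partial>\<mu>) \<le> (\<integral>\<^sup>+ y \<in> B. 1 \<partial>\<mu>)"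
      by (simp add: G \<mu>_eq) (intro emeasure_mono, auto)
  qed (auto simp: \<mu>.emeasure_space_1[simplified])
  ultimately have "AE y in \<mu>. (\<forall>p q. p \<le> q \<longrightarrow> G q y \<le> G p y) \<and> (\<forall>q. G q y \<le> 1)"
    by (simp add: AE_all_countable AE_conj_iff)
  then show ?thesis
    using that[of G, OF G_meas] G unfolding \<mu>_def by blast
qed

text \<open>Quantile transform: the conditional law of the first coordinate is sampled by applying the
  generalised inverse of its conditional tail function to a uniform variable.\<close>

lemma conditional_quantile_transform:
  fixes Q :: "(real \<times> 'y) measure"
  assumes Q: "prob_space Q" and sets_Q [measurable_cong]: "sets Q = sets (borel \<Otimes>\<^sub>M Y)"
    and unit: "AE w in Q. fst w \<in> {0..1}"
  obtains T where "T \<in> Y \<Otimes>\<^sub>M borel \<rightarrow>\<^sub>M borel"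
    "distr (distr Q Y snd \<Otimes>\<^sub>M unit_uniform) (borel \<Otimes>\<^sub>M Y) (\<lambda>(y, u). (T (y, u), y)) = Q"
proof -
  interpret Q: prob_space Q by fact
  define \<mu> where "\<mu> = distr Q Y snd"
  have sets_\<mu> [simp, measurable_cong]: "sets \<mu> = sets Y" by (simp add: \<mu>_def)
  have space_\<mu> [simp]: "space \<mu> = space Y" by (simp add: \<mu>_def)
  have space_Q: "space Q = UNIV \<times> space Y"
    using sets_eq_imp_space_eq[OF sets_Q] by (simp add: space_pair_measure)
  interpret \<mu>: prob_space \<mu> unfolding \<mu>_def by (rule Q.prob_space_distr) measurable
  interpret U: prob_space unit_uniform by (rule prob_space_unit_uniform)
  obtain G :: "rat \<Rightarrow> 'y \<Rightarrow> ennreal" where G_meas [measurable]: "\<And>q. G q \<in> borel_measurable Y"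
    and G: "\<And>q B. B \<in> sets Y \<Longrightarrow> (\<integral>\<^sup>+ y \<in> B. G q y \<partial>\<mu>) = emeasure Q ({of_rat q<..} \<times> B)"
    and G_AE: "AE y in \<mu>. (\<forall>p q. p \<le> q \<longrightarrow> G q y \<le> G p y) \<and> (\<forall>q. G q y \<le> 1)"
    using conditional_tail_densities[OF Q sets_Q] unfolding \<mu>_def by blast
  \<comment> \<open>Inserting 0 and restricting \<open>q\<close> to \<open>[0, 1]\<close> make the
    set nonempty and bounded for every \<open>w\<close>, so \<open>Sup\<close> behaves well even on
    the exceptional null set.\<close>
  define S where "S w = insert 0 {of_rat q :: real | q. 0 \<le> q \<and> q \<le> 1 \<and> ennreal (snd w) \<le> G q (fst w)}"
    for w :: "'y \<times> real"
  define T :: "'y \<times> real \<Rightarrow> real" where "T w = Sup (S w)" for w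
  \<comment> \<open>Superlevel sets of \<open>T\<close> become countable unions over rationals,
    which gives measurability and later the law of \<open>T\<close>.\<close>
  have T_gr: "s < T w \<longleftrightarrow> s < 0 \<or> (\<exists>q::rat. 0 \<le> q \<and> q \<le> 1 \<and> s < of_rat q \<and> ennreal (snd w) \<le> G q (fst w))" for s w
  proof -
    have "bdd_above (S w)"
      by (rule bdd_aboveI[of _ 1]) (auto simp: S_def)
    then have "s < T w \<longleftrightarrow> (\<exists>x \<in> S w. s < x)"
      unfolding T_def by (intro less_cSup_iff) (auto simp: S_def)
    then show ?thesis by (auto simp: S_def)
  qed
  have T_meas [measurable]: "T \<in> Y \<Otimes>\<^sub>M borel \<rightarrow>\<^sub>M borel"
    unfolding borel_measurable_iff_greater T_gr by measurable
  define D where "D = distr (\<mu> \<Otimes>\<^sub>M unit_uniform) (borel \<Otimes>\<^sub>M Y) (\<lambda>(y, u). (T (y, u), y))"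
  have sets_D [simp, measurable_cong]: "sets D = sets (borel \<Otimes>\<^sub>M Y)" by (simp add: D_def)
  have D: "emeasure D (A \<times> B) = (\<integral>\<^sup>+ y \<in> B. emeasure unit_uniform {u. T (y, u) \<in> A} \<partial>\<mu>)"
    if [measurable]: "A \<in> sets borel" "B \<in> sets Y" for A B
  proof -
    have "emeasure D (A \<times> B) = emeasure (\<mu> \<Otimes>\<^sub>M unit_uniform)
      ((\<lambda>(y, u). (T (y, u), y)) -` (A \<times> B) \<inter> space (\<mu> \<Otimes>\<^sub>M unit_uniform))"
      unfolding D_def by (intro emeasure_distr) measurable
    also have "\<dots> = (\<integral>\<^sup>+ y. emeasure unit_uniform
      (Pair y -` ((\<lambda>(y, u). (T (y, u), y)) -` (A \<times> B) \<inter> space (\<mu> \<Otimes>\<^sub>M unit_uniform))) \<partial>\<mu>)"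
      by (intro U.emeasure_pair_measure_alt measurable_sets[where A="borel \<Otimes>\<^sub>M Y"]) measurable
    also have "\<dots> = (\<integral>\<^sup>+ y \<in> B. emeasure unit_uniform {u. T (y, u) \<in> A} \<partial>\<mu>)"
    proof (rule nn_integral_cong)
      fix y assume "y \<in> space \<mu>"
      then have "Pair y -` ((\<lambda>(y, u). (T (y, u), y)) -` (A \<times> B) \<inter> space (\<mu> \<Otimes>\<^sub>M unit_uniform)) =
        (if y \<in> B then {u. T (y, u) \<in> A} else {})"
        by (auto simp: space_pair_measure)
      then show "emeasure unit_uniform
        (Pair y -` ((\<lambda>(y, u). (T (y, u), y)) -` (A \<times> B) \<inter> space (\<mu> \<Otimes>\<^sub>M unit_uniform))) =
        emeasure unit_uniform {u. T (y, u) \<in> A} * indicator B y"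
        by simp
    qed
    finally show ?thesis .
  qed
  have whole: "emeasure D (UNIV \<times> B) = emeasure Q (UNIV \<times> B)" if [measurable]: "B \<in> sets Y" for B
  proof -
    have "snd -` B \<inter> space Q = UNIV \<times> B"
      using sets.sets_into_space[OF that] by (auto simp: space_Q)
    then have "emeasure \<mu> B = emeasure Q (UNIV \<times> B)"
      by (simp add: \<mu>_def emeasure_distr)
    then show ?thesis
      by (simp add: D U.emeasure_space_1[simplified])
  qed
  \<comment> \<open>Since the first coordinate lies in \<open>[0, 1]\<close>, a tail is everything
    for \<open>s < 0\<close> and null for \<open>1 \<le> s\<close>; only the range between uses
    \<open>G\<close>.\<close>
  have tail: "emeasure D ({s<..} \<times> B) = emeasure Q ({s<..} \<times> B)" if [measurable]: "B \<in> sets Y" for s B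
  proof -
    consider "s < 0" | "0 \<le> s" "s < 1" | "1 \<le> s" by linarith
    then show ?thesis
    proof cases
      case 1
      then have "emeasure D ({s<..} \<times> B) = emeasure D (UNIV \<times> B)"
        by (simp add: D T_gr)
      also have "\<dots> = emeasure Q (UNIV \<times> B)" by (rule whole) fact
      also have "\<dots> = emeasure Q ({s<..} \<times> B)"
        using unit 1 by (intro emeasure_eq_AE) (auto elim!: eventually_mono)
      finally show ?thesis .
    next
      case 2
      obtain q :: "nat \<Rightarrow> rat" where q: "decseq q" "\<And>n. s < of_rat (q n)" "\<And>n. of_rat (q n) < (1::real)"
        "(\<lambda>n. of_rat (q n) :: real) \<longlonglongrightarrow> s"
        using decreasing_rat_seq[OF 2(2)] by metis
      have below: "\<exists>n. of_rat (q n) < t" if "s < t" for t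
        using eventually_happens'[OF sequentially_bot order_tendstoD(2)[OF q(4) that]] .
      have q01: "0 \<le> q n" "q n \<le> 1" for n
      proof -
        have "(0::real) \<le> of_rat (q n)" "of_rat (q n) \<le> (1::real)"
          using q(2,3)[of n] 2(1) by linarith+
        then show "0 \<le> q n" "q n \<le> 1" by simp_all
      qed
      \<comment> \<open>By monotonicity of \<open>G\<close> in \<open>q\<close>, the event that
        \<open>T\<close> exceeds \<open>s\<close> is the increasing union of the events
        \<open>ennreal u \<le> G (q n) y\<close>, of probability \<open>G (q n) y\<close>.\<close>
      have "AE y in \<mu>. emeasure unit_uniform {u. T (y, u) \<in> {s<..}} = (SUP n. G (q n) y)"
        using G_AE
      proof eventually_elim
        case (elim y)
        have "{u. T (y, u) \<in> {s<..}} = (\<Union>n. {u. ennreal u \<le> G (q n) y})"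
        proof (intro set_eqI iffI)
          fix u assume "u \<in> {u. T (y, u) \<in> {s<..}}"
          then obtain p :: rat where p: "s < of_rat p" "ennreal u \<le> G p y"
            using 2 by (auto simp: T_gr)
          then obtain n where "of_rat (q n) < (of_rat p :: real)" using below by blast
          then have "q n \<le> p" by (simp add: of_rat_less)
          then have "G p y \<le> G (q n) y" using elim by blast
          with p show "u \<in> (\<Union>n. {u. ennreal u \<le> G (q n) y})" by (auto intro: order_trans)
        next
          fix u assume "u \<in> (\<Union>n. {u. ennreal u \<le> G (q n) y})"
          then show "u \<in> {u. T (y, u) \<in> {s<..}}" using q(2) q01 by (auto simp: T_gr)
        qed
        also have "emeasure unit_uniform \<dots> = (SUP n. emeasure unit_uniform {u. ennreal u \<le> G (q n) y})"
        proof (rule SUP_emeasure_incseq[symmetric])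
          show "incseq (\<lambda>n. {u. ennreal u \<le> G (q n) y})"
            using elim decseqD[OF q(1)] by (intro incseq_SucI) (auto intro: order_trans)
          have "{u. ennreal u \<le> G (q n) y} \<in> sets borel" for n by measurable
          then show "range (\<lambda>n. {u. ennreal u \<le> G (q n) y}) \<subseteq> sets unit_uniform" by auto
        qed
        also have "\<dots> = (SUP n. G (q n) y)"
          using elim by (simp add: emeasure_unit_uniform_le)
        finally show ?case .
      qed
      then have "emeasure D ({s<..} \<times> B) = (\<integral>\<^sup>+ y \<in> B. (SUP n. G (q n) y) \<partial>\<mu>)"
        by (subst D) (auto intro!: nn_integral_cong_AE elim!: eventually_mono)
      also have "\<dots> = (\<integral>\<^sup>+ y. (SUP n. G (q n) y * indicator B y) \<partial>\<mu>)"
        by (simp add: SUP_mult_right_ennreal)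
      \<comment> \<open>Monotone convergence moves the supremum outside; continuity from below of
        \<open>Q\<close> then reassembles the tail beyond \<open>s\<close>.\<close>
      also have "\<dots> = (SUP n. \<integral>\<^sup>+ y \<in> B. G (q n) y \<partial>\<mu>)"
      proof (rule nn_integral_monotone_convergence_SUP_AE)
        show "AE y in \<mu>. G (q n) y * indicator B y \<le> G (q (Suc n)) y * indicator B y" for n
          using G_AE by eventually_elim (use decseqD[OF q(1), of n "Suc n"] in \<open>auto intro!: mult_right_mono\<close>)
      qed measurable
      also have "\<dots> = (SUP n. emeasure Q ({of_rat (q n)<..} \<times> B))"
        by (simp add: G)
      also have "\<dots> = emeasure Q (\<Union>n. {of_rat (q n)<..} \<times> B)"
      proof (rule SUP_emeasure_incseq)
        show "incseq (\<lambda>n. {of_rat (q n) :: real<..} \<times> B)"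
        proof (rule incseq_SucI)
          fix n
          have "(of_rat (q (Suc n)) :: real) \<le> of_rat (q n)"
            using decseq_SucD[OF q(1)] by (simp add: of_rat_less_eq)
          from le_less_trans[OF this] show "{of_rat (q n) :: real<..} \<times> B \<subseteq> {of_rat (q (Suc n))<..} \<times> B"
            by auto
        qed
      qed auto
      also have "(\<Union>n. {of_rat (q n) :: real<..} \<times> B) = {s<..} \<times> B"
        using below q(2) by (auto intro: order.strict_trans)
      finally show ?thesis .
    next
      case 3
      then have "T (y, u) \<notin> {s<..}" for y u
      proof -
        have "of_rat q \<le> s" if "q \<le> 1" for q :: rat
        proof -
          have "(of_rat q :: real) \<le> 1" using that by simp
          then show ?thesis using 3 by linarith
        qed
        then show ?thesis using 3 by (fastforce simp: T_gr not_less)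
      qed
      then have "emeasure D ({s<..} \<times> B) = 0" by (subst D) auto
      moreover have "emeasure Q ({s<..} \<times> B) = emeasure Q {}"
      proof (rule emeasure_eq_AE)
        show "AE w in Q. w \<in> {s<..} \<times> B \<longleftrightarrow> w \<in> {}"
          using unit by eventually_elim (use 3 in auto)
      qed auto
      ultimately show ?thesis by simp
    qed
  qed
  have prob_D: "prob_space D"
    unfolding D_def by (intro prob_space.prob_space_distr prob_space_pair) (auto simp: \<mu>.prob_space_axioms U.prob_space_axioms)
  then interpret D: prob_space D .
  have "D = Q"
  proof (rule measure_eqI_generator_eq[OF Int_stable_pair_measure_generator[of "borel :: real measure" Y],
        where A="\<lambda>_. UNIV \<times> space Y" and \<Omega>="UNIV \<times> space Y"])
    show "{a \<times> b |a b. a \<in> sets borel \<and> b \<in> sets Y} \<subseteq> Pow (UNIV \<times> space Y)"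
      using sets.sets_into_space by fastforce
    fix W assume "W \<in> {a \<times> b |a b. a \<in> sets (borel :: real measure) \<and> b \<in> sets Y}"
    then obtain A B where W: "W = A \<times> B" and A: "A \<in> sets borel" and B [measurable]: "B \<in> sets Y" by auto
    \<comment> \<open>For fixed \<open>B\<close>, the first marginal of the part of \<open>N\<close>
      over \<open>B\<close> is a finite measure on the line and hence determined by its tails; this
      passes from tails to all rectangles.\<close>
    define R where "R N = distr (density N (indicator (UNIV \<times> B))) (borel :: real measure) fst" for N :: "(real \<times> 'y) measure"
    have R: "emeasure (R N) A = emeasure N (A \<times> B)"
      if [measurable_cong]: "sets N = sets (borel \<Otimes>\<^sub>M Y)" and [measurable]: "A \<in> sets borel" for N A
    proof -
      have "space N = UNIV \<times> space Y"
        using sets_eq_imp_space_eq[OF that(1)] by (simp add: space_pair_measure)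
      then have "fst -` A \<inter> space N = A \<times> space Y" by auto
      moreover have "(UNIV \<times> B) \<inter> (A \<times> space Y) = A \<times> B"
        using sets.sets_into_space[OF B] by auto
      ultimately show ?thesis
        by (simp add: R_def emeasure_distr emeasure_density flip: indicator_inter_arith)
    qed
    have "R D = R Q"
    proof (rule measure_eqI_lessThan)
      show "emeasure (R D) {x<..} < \<infinity>" for x
        using D.emeasure_finite by (simp add: R less_top[symmetric])
      show "emeasure (R D) {x<..} = emeasure (R Q) {x<..}" for x
        using tail[OF B] by (simp add: R sets_Q)
    qed (simp_all add: R_def)
    then show "emeasure D W = emeasure Q W"
      using R[OF sets_D A] R[OF sets_Q A] by (simp add: W)
  qed (auto simp: sets_pair_measure sets_Q intro!: exI[of _ "UNIV :: real set"])
  then show ?thesis using that[OF T_meas] by (simp add: D_def \<mu>_def)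
qed

section \<open>Integrals against kernels and disintegration\<close>

text \<open>The arbitrary map \<open>k\<close> covers joint laws whose coordinates are reordered,
  and triples with one coordinate held fixed.\<close>

lemma nn_integral_kernel_joint:
  assumes \<mu>: "prob_space \<mu>" "sets \<mu> = sets A" and \<kappa>: "\<kappa> \<in> A \<rightarrow>\<^sub>M prob_algebra B"
    and k: "(\<lambda>(a, b). k a b) \<in> A \<Otimes>\<^sub>M B \<rightarrow>\<^sub>M W" and h [measurable]: "h \<in> borel_measurable W"
  shows "(\<integral>\<^sup>+ w. h w \<partial>(do {a \<leftarrow> \<mu>; b \<leftarrow> \<kappa> a; return W (k a b)})) =
    (\<integral>\<^sup>+ a. \<integral>\<^sup>+ b. h (k a b) \<partial>\<kappa> a \<partial>\<mu>)"
proof -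
  note [measurable_cong] = \<mu>(2)
  note [measurable] = measurable_prob_algebraD[OF \<kappa>]
  have space_\<mu>: "space \<mu> = space A" using \<mu>(2) by (rule sets_eq_imp_space_eq)
  have [measurable]: "(\<lambda>p. return W (k (fst p) (snd p))) \<in> A \<Otimes>\<^sub>M B \<rightarrow>\<^sub>M subprob_algebra W"
    using measurable_compose[OF k return_measurable] by (simp add: split_beta')
  have "(\<lambda>a. \<kappa> a \<bind> (\<lambda>b. return W (k a b))) \<in> A \<rightarrow>\<^sub>M subprob_algebra W"
    by (rule measurable_bind[where N=B]) measurable
  then have "(\<integral>\<^sup>+ w. h w \<partial>(do {a \<leftarrow> \<mu>; b \<leftarrow> \<kappa> a; return W (k a b)})) =
    (\<integral>\<^sup>+ a. \<integral>\<^sup>+ w. h w \<partial>(\<kappa> a \<bind> (\<lambda>b. return W (k a b))) \<partial>\<mu>)"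
    by (intro nn_integral_bind[where B=W]) measurable
  also have "\<dots> = (\<integral>\<^sup>+ a. \<integral>\<^sup>+ b. h (k a b) \<partial>\<kappa> a \<partial>\<mu>)"
  proof (rule nn_integral_cong)
    fix a assume "a \<in> space \<mu>"
    then have a: "a \<in> space A" by (simp add: space_\<mu>)
    have sets_\<kappa> [measurable_cong]: "sets (\<kappa> a) = sets B"
      using measurable_space[OF \<kappa> a] by (simp add: space_prob_algebra)
    have ka [measurable]: "k a \<in> \<kappa> a \<rightarrow>\<^sub>M W"
      using measurable_Pair2[OF k a] by (simp add: measurable_cong_sets[OF sets_\<kappa> refl])
    have "(\<integral>\<^sup>+ w. h w \<partial>(\<kappa> a \<bind> (\<lambda>b. return W (k a b)))) = (\<integral>\<^sup>+ b. \<integral>\<^sup>+ w. h w \<partial>return W (k a b) \<partial>\<kappa> a)"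
      by (intro nn_integral_bind[where B=W]) measurable
    also have "\<dots> = (\<integral>\<^sup>+ b. h (k a b) \<partial>\<kappa> a)"
      by (intro nn_integral_cong nn_integral_return) (auto intro: measurable_space[OF ka])
    finally show "(\<integral>\<^sup>+ w. h w \<partial>(\<kappa> a \<bind> (\<lambda>b. return W (k a b)))) = (\<integral>\<^sup>+ b. h (k a b) \<partial>\<kappa> a)" .
  qed
  finally show ?thesis .
qed

lemma kernel_joint_in_prob_algebra:
  assumes \<mu>: "prob_space \<mu>" "sets \<mu> = sets A" and \<kappa>: "\<kappa> \<in> A \<rightarrow>\<^sub>M prob_algebra B"
    and k: "(\<lambda>(a, b). k a b) \<in> A \<Otimes>\<^sub>M B \<rightarrow>\<^sub>M W"
  shows "do {a \<leftarrow> \<mu>; b \<leftarrow> \<kappa> a; return W (k a b)} \<in> space (prob_algebra W)"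
proof -
  have \<mu>': "\<mu> \<in> space (prob_algebra A)" using \<mu> by (simp add: space_prob_algebra)
  note [measurable] = \<kappa>
  have [measurable]: "(\<lambda>p. return W (k (fst p) (snd p))) \<in> A \<Otimes>\<^sub>M B \<rightarrow>\<^sub>M prob_algebra W"
    using measurable_compose[OF k measurable_return_prob_space] by (simp add: split_beta')
  have "(\<lambda>a. \<kappa> a \<bind> (\<lambda>b. return W (k a b))) \<in> A \<rightarrow>\<^sub>M prob_algebra W"
    by measurable
  from prob_space_bind'[OF \<mu>' this] sets_bind'[OF \<mu>' this] show ?thesis
    by (simp add: space_prob_algebra)
qed

lemma measure_eqI_nn_integral:
  assumes sets: "sets M = sets N"
    and eq: "\<And>h. h \<in> borel_measurable M \<Longrightarrow> (\<integral>\<^sup>+ w. h w \<partial>M) = (\<integral>\<^sup>+ w. h w \<partial>N)"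
  shows "M = N"
proof (rule measure_eqI[OF sets])
  fix A assume "A \<in> sets M"
  then show "emeasure M A = emeasure N A"
    using eq[of "indicator A"] sets by simp
qed

text \<open>Transport the first coordinate to the unit interval by the coding map, disintegrate
  there by quantiles, and return by the left inverse \<open>r\<close>.\<close>

theorem standard_borel_disintegration:
  fixes P :: "('x \<times> 'y) measure"
  assumes X: "standard_borel X" and P: "prob_space P" and sets_P [measurable_cong]: "sets P = sets (X \<Otimes>\<^sub>M Y)"
  obtains \<kappa> where "\<kappa> \<in> Y \<rightarrow>\<^sub>M prob_algebra X"
    "P = do {y \<leftarrow> distr P Y snd; x \<leftarrow> \<kappa> y; return (X \<Otimes>\<^sub>M Y) (x, y)}"
proof -
  interpret P: prob_space P by fact
  interpret U: prob_space unit_uniform by (rule prob_space_unit_uniform)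
  have space_P: "space P = space X \<times> space Y"
    using sets_eq_imp_space_eq[OF sets_P] by (simp add: space_pair_measure)
  have ne: "space X \<noteq> {}" using P.not_empty space_P by auto
  obtain f r where [measurable]: "f \<in> X \<rightarrow>\<^sub>M borel" and f01: "\<And>x. f x \<in> {0..1::real}"
    and [measurable]: "r \<in> borel \<rightarrow>\<^sub>M X" and rf: "\<And>x. x \<in> space X \<Longrightarrow> r (f x) = x"
    using standard_borel_real_coding[OF X ne] by metis
  define Q where "Q = distr P (borel \<Otimes>\<^sub>M Y) (\<lambda>w. (f (fst w), snd w))"
  have sets_Q [simp, measurable_cong]: "sets Q = sets (borel \<Otimes>\<^sub>M Y)" by (simp add: Q_def)
  have "prob_space Q" unfolding Q_def by (rule P.prob_space_distr) measurable
  moreover have "AE w in Q. fst w \<in> {0..1}"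
    unfolding Q_def by (subst AE_distr_iff) (use f01 in auto)
  ultimately obtain T where T [measurable]: "T \<in> Y \<Otimes>\<^sub>M borel \<rightarrow>\<^sub>M borel"
    and Q_eq: "distr (distr Q Y snd \<Otimes>\<^sub>M unit_uniform) (borel \<Otimes>\<^sub>M Y) (\<lambda>(y, u). (T (y, u), y)) = Q"
    using conditional_quantile_transform[OF _ sets_Q] by blast
  define \<mu> where "\<mu> = distr P Y snd"
  have sets_\<mu> [simp, measurable_cong]: "sets \<mu> = sets Y" by (simp add: \<mu>_def)
  have \<mu>_Q: "distr Q Y snd = \<mu>"
    unfolding Q_def \<mu>_def by (subst distr_distr) (auto simp: comp_def)
  have prob_\<mu>: "prob_space \<mu>" unfolding \<mu>_def by (rule P.prob_space_distr) measurable
  have U: "unit_uniform \<in> space (prob_algebra borel)"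
    by (simp add: space_prob_algebra U.prob_space_axioms)
  \<comment> \<open>The law of the decoded conditional quantile at a uniform argument. As a
    pushforward of one fixed law it depends measurably on \<open>y\<close>.\<close>
  define \<kappa> where "\<kappa> y = distr unit_uniform X (\<lambda>u. r (T (y, u)))" for y
  have \<kappa>: "\<kappa> \<in> Y \<rightarrow>\<^sub>M prob_algebra X"
    unfolding \<kappa>_def[abs_def]
    by (rule measurable_distr_prob_space2[where M=borel]) (use U in \<open>auto intro: measurable_const\<close>)
  \<comment> \<open>Coding followed by decoding is the identity on the carrier of
    \<open>X\<close>.\<close>
  have "P = distr Q (X \<Otimes>\<^sub>M Y) (\<lambda>w. (r (fst w), snd w))"
  proof -
    have "distr Q (X \<Otimes>\<^sub>M Y) (\<lambda>w. (r (fst w), snd w)) = distr P (X \<Otimes>\<^sub>M Y) (\<lambda>w. (r (f (fst w)), snd w))"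
      unfolding Q_def by (subst distr_distr) (auto simp: comp_def)
    also have "\<dots> = distr P P (\<lambda>w. w)"
      by (rule distr_cong) (auto simp: sets_P space_P rf)
    finally show ?thesis by (simp add: distr_id2)
  qed
  also have "\<dots> = distr (\<mu> \<Otimes>\<^sub>M unit_uniform) (X \<Otimes>\<^sub>M Y) (\<lambda>(y, u). (r (T (y, u)), y))"
    by (subst Q_eq[symmetric], unfold \<mu>_Q, subst distr_distr) (auto simp: comp_def split_beta')
  finally have P_eq: "P = distr (\<mu> \<Otimes>\<^sub>M unit_uniform) (X \<Otimes>\<^sub>M Y) (\<lambda>(y, u). (r (T (y, u)), y))" .
  have swap: "(\<lambda>(y, x). (x, y)) \<in> Y \<Otimes>\<^sub>M X \<rightarrow>\<^sub>M X \<Otimes>\<^sub>M Y" by measurable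
  have "P = do {y \<leftarrow> \<mu>; x \<leftarrow> \<kappa> y; return (X \<Otimes>\<^sub>M Y) (x, y)}"
  proof (rule measure_eqI_nn_integral)
    show "sets P = sets (do {y \<leftarrow> \<mu>; x \<leftarrow> \<kappa> y; return (X \<Otimes>\<^sub>M Y) (x, y)})"
      using kernel_joint_in_prob_algebra[OF prob_\<mu> sets_\<mu> \<kappa> swap] by (simp add: space_prob_algebra sets_P)
    fix h :: "'x \<times> 'y \<Rightarrow> ennreal" assume "h \<in> borel_measurable P"
    then have h [measurable]: "h \<in> borel_measurable (X \<Otimes>\<^sub>M Y)" by measurable
    have "(\<integral>\<^sup>+ w. h w \<partial>P) = (\<integral>\<^sup>+ p. h (r (T p), fst p) \<partial>(\<mu> \<Otimes>\<^sub>M unit_uniform))"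
      by (subst P_eq, subst nn_integral_distr) (auto simp: split_beta')
    also have "\<dots> = (\<integral>\<^sup>+ y. \<integral>\<^sup>+ u. h (r (T (y, u)), y) \<partial>unit_uniform \<partial>\<mu>)"
      by (subst U.nn_integral_fst[symmetric]) auto
    also have "\<dots> = (\<integral>\<^sup>+ y. \<integral>\<^sup>+ x. h (x, y) \<partial>\<kappa> y \<partial>\<mu>)"
    proof (rule nn_integral_cong)
      fix y assume "y \<in> space \<mu>"
      then have [measurable]: "y \<in> space Y" by (simp add: \<mu>_def)
      show "(\<integral>\<^sup>+ u. h (r (T (y, u)), y) \<partial>unit_uniform) = (\<integral>\<^sup>+ x. h (x, y) \<partial>\<kappa> y)"
        unfolding \<kappa>_def by (subst nn_integral_distr) auto
    qed
    also have "\<dots> = (\<integral>\<^sup>+ w. h w \<partial>(do {y \<leftarrow> \<mu>; x \<leftarrow> \<kappa> y; return (X \<Otimes>\<^sub>M Y) (x, y)}))"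
      by (rule nn_integral_kernel_joint[OF prob_\<mu> sets_\<mu> \<kappa> swap h, symmetric])
    finally show "(\<integral>\<^sup>+ w. h w \<partial>P) = (\<integral>\<^sup>+ w. h w \<partial>(do {y \<leftarrow> \<mu>; x \<leftarrow> \<kappa> y; return (X \<Otimes>\<^sub>M Y) (x, y)}))" .
  qed
  then show ?thesis using that[OF \<kappa>] by (simp add: \<mu>_def)
qed

section \<open>The generative model\<close>

locale generative_model =
  fixes X :: "'x measure" and Y :: "'y measure" and Z :: "'z measure"
    and P :: "('x \<times> 'y) measure" and PZ :: "'z measure"
  assumes P: "prob_space P" and sets_P [measurable_cong]: "sets P = sets (X \<Otimes>\<^sub>M Y)"
    and PZ: "prob_space PZ" and sets_PZ [measurable_cong]: "sets PZ = sets Z"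
begin

lemma sets_marg_y [simp, measurable_cong]: "sets (marg_y Y P) = sets Y"
  by (simp add: marg_y_def)

lemma prob_space_marg_y: "prob_space (marg_y Y P)"
  unfolding marg_y_def using P by (rule prob_space.prob_space_distr) measurable

lemma sets_marg_x [simp, measurable_cong]: "sets (marg_x X P) = sets X"
  by (simp add: marg_x_def)

lemma prob_space_marg_x: "prob_space (marg_x X P)"
  unfolding marg_x_def using P by (rule prob_space.prob_space_distr) measurable

lemma marg_y_in_prob_algebra: "marg_y Y P \<in> space (prob_algebra Y)"
  by (simp add: space_prob_algebra prob_space_marg_y)

lemma PZ_in_prob_algebra: "PZ \<in> space (prob_algebra Z)"
  using PZ sets_PZ by (simp add: space_prob_algebra)

lemma space_marg_y: "space (marg_y Y P) = space Y"
  by (rule sets_eq_imp_space_eq) simp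

lemma space_PZ: "space PZ = space Z"
  using sets_PZ by (rule sets_eq_imp_space_eq)

section \<open>Laws induced by a fixed generator\<close>

context
  fixes g :: "'y \<times> 'z \<Rightarrow> 'x measure"
  assumes g: "g \<in> Y \<Otimes>\<^sub>M Z \<rightarrow>\<^sub>M prob_algebra X"
begin

lemma generator_slice_z: "z \<in> space Z \<Longrightarrow> (\<lambda>y. g (y, z)) \<in> Y \<rightarrow>\<^sub>M prob_algebra X"
  by (rule measurable_compose[OF measurable_Pair2' g])

lemma generator_slice_y: "y \<in> space Y \<Longrightarrow> (\<lambda>z. g (y, z)) \<in> Z \<rightarrow>\<^sub>M prob_algebra X"
  by (rule measurable_compose[OF measurable_Pair1' g])

lemma gen_given_z_measurable: "gen_given_z Y P g \<in> Z \<rightarrow>\<^sub>M prob_algebra X"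
  unfolding gen_given_z_def[abs_def]
proof (rule measurable_bind_prob_space2[where N=Y])
  show "(\<lambda>z. marg_y Y P) \<in> Z \<rightarrow>\<^sub>M prob_algebra Y"
    using marg_y_in_prob_algebra by simp
  show "(\<lambda>(z, y). g (y, z)) \<in> Z \<Otimes>\<^sub>M Y \<rightarrow>\<^sub>M prob_algebra X"
    using measurable_compose[OF measurable_pair_swap' g] by (simp add: split_beta')
qed

lemma gen_given_y_measurable: "gen_given_y PZ g \<in> Y \<rightarrow>\<^sub>M prob_algebra X"
  unfolding gen_given_y_def[abs_def]
proof (rule measurable_bind_prob_space2[where N=Z])
  show "(\<lambda>y. PZ) \<in> Y \<rightarrow>\<^sub>M prob_algebra Z"
    using PZ_in_prob_algebra by simp
  show "(\<lambda>(y, z). g (y, z)) \<in> Y \<Otimes>\<^sub>M Z \<rightarrow>\<^sub>M prob_algebra X"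
    using g by simp
qed

lemma nn_integral_gen_given_z:
  assumes "z \<in> space Z" "h \<in> borel_measurable X"
  shows "(\<integral>\<^sup>+ x. h x \<partial>gen_given_z Y P g z) = (\<integral>\<^sup>+ y. \<integral>\<^sup>+ x. h x \<partial>g (y, z) \<partial>marg_y Y P)"
  unfolding gen_given_z_def using assms measurable_prob_algebraD[OF generator_slice_z]
  by (intro nn_integral_bind[where B=X]) (auto simp: measurable_cong_sets[OF sets_marg_y refl])

lemma nn_integral_gen_given_y:
  assumes "y \<in> space Y" "h \<in> borel_measurable X"
  shows "(\<integral>\<^sup>+ x. h x \<partial>gen_given_y PZ g y) = (\<integral>\<^sup>+ z. \<integral>\<^sup>+ x. h x \<partial>g (y, z) \<partial>PZ)"
  unfolding gen_given_y_def using assms measurable_prob_algebraD[OF generator_slice_y]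
  by (intro nn_integral_bind[where B=X]) (auto simp: measurable_cong_sets[OF sets_PZ refl])

lemma nn_integral_gen_joint_xyz:
  assumes h: "h \<in> borel_measurable (X \<Otimes>\<^sub>M (Y \<Otimes>\<^sub>M Z))"
  shows "(\<integral>\<^sup>+ w. h w \<partial>gen_joint_xyz X Y Z P PZ g) =
    (\<integral>\<^sup>+ y. \<integral>\<^sup>+ z. \<integral>\<^sup>+ x. h (x, y, z) \<partial>g (y, z) \<partial>PZ \<partial>marg_y Y P)"
proof -
  let ?W = "X \<Otimes>\<^sub>M (Y \<Otimes>\<^sub>M Z)"
  note [measurable] = g
  have "(\<lambda>y. do {z \<leftarrow> PZ; x \<leftarrow> g (y, z); return ?W (x, y, z)}) \<in> Y \<rightarrow>\<^sub>M prob_algebra ?W"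
  proof (rule measurable_bind_prob_space2[where N=Z])
    show "(\<lambda>y. PZ) \<in> Y \<rightarrow>\<^sub>M prob_algebra Z"
      using PZ_in_prob_algebra by simp
    have "(\<lambda>w. g w \<bind> (\<lambda>x. return ?W (x, w))) \<in> Y \<Otimes>\<^sub>M Z \<rightarrow>\<^sub>M prob_algebra ?W"
    proof (rule measurable_bind_prob_space2[OF g])
      have "(\<lambda>(w, x). (x, w)) \<in> (Y \<Otimes>\<^sub>M Z) \<Otimes>\<^sub>M X \<rightarrow>\<^sub>M ?W" by measurable
      from measurable_compose[OF this measurable_return_prob_space]
      show "(\<lambda>(w, x). return ?W (x, w)) \<in> (Y \<Otimes>\<^sub>M Z) \<Otimes>\<^sub>M X \<rightarrow>\<^sub>M prob_algebra ?W"
        by (simp add: split_beta')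
    qed
    then show "(\<lambda>(y, z). g (y, z) \<bind> (\<lambda>x. return ?W (x, y, z))) \<in> Y \<Otimes>\<^sub>M Z \<rightarrow>\<^sub>M prob_algebra ?W"
      by (simp add: split_beta')
  qed
  then have "(\<integral>\<^sup>+ w. h w \<partial>gen_joint_xyz X Y Z P PZ g) =
    (\<integral>\<^sup>+ y. \<integral>\<^sup>+ w. h w \<partial>(do {z \<leftarrow> PZ; x \<leftarrow> g (y, z); return ?W (x, y, z)}) \<partial>marg_y Y P)"
    unfolding gen_joint_xyz_def
    by (intro nn_integral_bind[OF h])
      (simp add: measurable_cong_sets[OF sets_marg_y refl] measurable_prob_algebraD)
  also have "\<dots> = (\<integral>\<^sup>+ y. \<integral>\<^sup>+ z. \<integral>\<^sup>+ x. h (x, y, z) \<partial>g (y, z) \<partial>PZ \<partial>marg_y Y P)"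
  proof (rule nn_integral_cong)
    fix y assume "y \<in> space (marg_y Y P)"
    then have [measurable]: "y \<in> space Y" by (simp add: space_marg_y)
    show "(\<integral>\<^sup>+ w. h w \<partial>(do {z \<leftarrow> PZ; x \<leftarrow> g (y, z); return ?W (x, y, z)})) =
      (\<integral>\<^sup>+ z. \<integral>\<^sup>+ x. h (x, y, z) \<partial>g (y, z) \<partial>PZ)"
      by (rule nn_integral_kernel_joint[OF PZ sets_PZ generator_slice_y _ h]) measurable
  qed
  finally show ?thesis .
qed

lemma gen_joint_xz_in_prob_algebra: "gen_joint_xz X Y Z P PZ g \<in> space (prob_algebra (X \<Otimes>\<^sub>M Z))"
  unfolding gen_joint_xz_def
  by (rule kernel_joint_in_prob_algebra[OF PZ sets_PZ gen_given_z_measurable]) measurable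

lemma gen_joint_xy_in_prob_algebra: "gen_joint_xy X Y P PZ g \<in> space (prob_algebra (X \<Otimes>\<^sub>M Y))"
  unfolding gen_joint_xy_def
  by (rule kernel_joint_in_prob_algebra[OF prob_space_marg_y sets_marg_y gen_given_y_measurable]) measurable

text \<open>The law of \<open>(x, z)\<close> is a marginal of the law of the triple. The triple
  draws \<open>y\<close> before \<open>z\<close>, the pair law draws \<open>z\<close> first, so the
  order of integration has to be exchanged.\<close>

lemma nn_integral_gen_joint_xz:
  assumes h [measurable]: "h \<in> borel_measurable (X \<Otimes>\<^sub>M Z)"
  shows "(\<integral>\<^sup>+ w. h w \<partial>gen_joint_xz X Y Z P PZ g) =
    (\<integral>\<^sup>+ (x, y, z). h (x, z) \<partial>gen_joint_xyz X Y Z P PZ g)"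
proof -
  interpret PZ: prob_space PZ by (rule PZ)
  interpret PY: prob_space "marg_y Y P" by (rule prob_space_marg_y)
  interpret pair_sigma_finite "marg_y Y P" PZ ..
  have "(\<lambda>w. \<integral>\<^sup>+ x. h (x, snd w) \<partial>g w) \<in> borel_measurable (Y \<Otimes>\<^sub>M Z)"
    by (rule nn_integral_measurable_subprob_algebra2[OF _ measurable_prob_algebraD[OF g]]) measurable
  then have inner: "(\<lambda>(y, z). \<integral>\<^sup>+ x. h (x, z) \<partial>g (y, z)) \<in> borel_measurable (marg_y Y P \<Otimes>\<^sub>M PZ)"
    by (simp add: split_beta' measurable_cong_sets[OF sets_pair_measure_cong[OF sets_marg_y sets_PZ] refl])
  have "(\<integral>\<^sup>+ w. h w \<partial>gen_joint_xz X Y Z P PZ g) =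
    (\<integral>\<^sup>+ z. \<integral>\<^sup>+ x. h (x, z) \<partial>gen_given_z Y P g z \<partial>PZ)"
    unfolding gen_joint_xz_def
    by (rule nn_integral_kernel_joint[OF PZ sets_PZ gen_given_z_measurable _ h]) measurable
  also have "\<dots> = (\<integral>\<^sup>+ z. \<integral>\<^sup>+ y. \<integral>\<^sup>+ x. h (x, z) \<partial>g (y, z) \<partial>marg_y Y P \<partial>PZ)"
    by (intro nn_integral_cong nn_integral_gen_given_z) (auto simp: space_PZ)
  also have "\<dots> = (\<integral>\<^sup>+ y. \<integral>\<^sup>+ z. \<integral>\<^sup>+ x. h (x, z) \<partial>g (y, z) \<partial>PZ \<partial>marg_y Y P)"
    \<comment> \<open>Tonelli for the independent pair of \<open>y\<close> and
      \<open>z\<close>.\<close>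
    using Fubini'[OF inner] by simp
  also have "\<dots> = (\<integral>\<^sup>+ (x, y, z). h (x, z) \<partial>gen_joint_xyz X Y Z P PZ g)"
    by (subst nn_integral_gen_joint_xyz) auto
  finally show ?thesis .
qed

lemma nn_integral_gen_joint_xy:
  assumes h [measurable]: "h \<in> borel_measurable (X \<Otimes>\<^sub>M Y)"
  shows "(\<integral>\<^sup>+ w. h w \<partial>gen_joint_xy X Y P PZ g) =
    (\<integral>\<^sup>+ (x, y, z). h (x, y) \<partial>gen_joint_xyz X Y Z P PZ g)"
proof -
  have "(\<integral>\<^sup>+ w. h w \<partial>gen_joint_xy X Y P PZ g) =
    (\<integral>\<^sup>+ y. \<integral>\<^sup>+ x. h (x, y) \<partial>gen_given_y PZ g y \<partial>marg_y Y P)"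
    unfolding gen_joint_xy_def
    by (rule nn_integral_kernel_joint[OF prob_space_marg_y sets_marg_y gen_given_y_measurable _ h]) measurable
  also have "\<dots> = (\<integral>\<^sup>+ y. \<integral>\<^sup>+ z. \<integral>\<^sup>+ x. h (x, y) \<partial>g (y, z) \<partial>PZ \<partial>marg_y Y P)"
    by (intro nn_integral_cong nn_integral_gen_given_y) (auto simp: space_marg_y)
  also have "\<dots> = (\<integral>\<^sup>+ (x, y, z). h (x, y) \<partial>gen_joint_xyz X Y Z P PZ g)"
    by (subst nn_integral_gen_joint_xyz) auto
  finally show ?thesis .
qed

text \<open>The bounds on a discriminator hold on the carrier only, so the carrier of the triple law
  must be known.\<close>

lemma space_gen_joint_xyz: "space (gen_joint_xyz X Y Z P PZ g) = space X \<times> space Y \<times> space Z"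
proof -
  have "space (gen_joint_xyz X Y Z P PZ g) = space (X \<Otimes>\<^sub>M (Y \<Otimes>\<^sub>M Z))"
    unfolding gen_joint_xyz_def
  proof (rule space_bind)
    fix y assume "y \<in> space (marg_y Y P)"
    then have y: "y \<in> space Y" by (simp add: space_marg_y)
    have "do {z \<leftarrow> PZ; x \<leftarrow> g (y, z); return (X \<Otimes>\<^sub>M (Y \<Otimes>\<^sub>M Z)) (x, y, z)} \<in>
      space (prob_algebra (X \<Otimes>\<^sub>M (Y \<Otimes>\<^sub>M Z)))"
      by (rule kernel_joint_in_prob_algebra[OF PZ sets_PZ generator_slice_y[OF y]]) (use y in measurable)
    then show "sets (do {z \<leftarrow> PZ; x \<leftarrow> g (y, z); return (X \<Otimes>\<^sub>M (Y \<Otimes>\<^sub>M Z)) (x, y, z)}) =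
      sets (X \<Otimes>\<^sub>M (Y \<Otimes>\<^sub>M Z))"
      by (simp add: space_prob_algebra)
  next
    show "space (marg_y Y P) \<noteq> {}" by (rule prob_space.not_empty[OF prob_space_marg_y])
  qed
  then show ?thesis by (simp add: space_pair_measure)
qed

lemma inf_joint_xz_in_prob_algebra:
  assumes i: "i \<in> X \<rightarrow>\<^sub>M prob_algebra Z"
  shows "inf_joint_xz X Z P i \<in> space (prob_algebra (X \<Otimes>\<^sub>M Z))"
  unfolding inf_joint_xz_def
  by (rule kernel_joint_in_prob_algebra[OF prob_space_marg_x sets_marg_x i]) measurable

text \<open>The second expectation runs over triples but its integrand ignores \<open>y\<close>, so
  it is an integral over the marginal law of \<open>(x, z)\<close>.\<close>

lemma loss_xz_eq_gan_cost:
  assumes i: "i \<in> X \<rightarrow>\<^sub>M prob_algebra Z" and D: "D \<in> discriminators (X \<Otimes>\<^sub>M Z)"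
  shows "loss_xz X Y Z P PZ D g i =
    - enn2ereal (gan_cost (inf_joint_xz X Z P i) (gen_joint_xz X Y Z P PZ g) D)"
proof -
  have [measurable]: "D \<in> borel_measurable (X \<Otimes>\<^sub>M Z)"
    and D01: "\<And>w. w \<in> space (X \<Otimes>\<^sub>M Z) \<Longrightarrow> 0 \<le> D w \<and> D w \<le> 1"
    using D by (auto simp: discriminators_def)
  have "sets (inf_joint_xz X Z P i) = sets (X \<Otimes>\<^sub>M Z)"
    using inf_joint_xz_in_prob_algebra[OF i] by (simp add: space_prob_algebra)
  from sets_eq_imp_space_eq[OF this] have "ereal_expectation (inf_joint_xz X Z P i) (\<lambda>w. elog (D w)) =
    - enn2ereal (\<integral>\<^sup>+ w. nlog (D w) \<partial>inf_joint_xz X Z P i)"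
    using D01 by (intro ereal_expectation_elog) auto
  moreover have "ereal_expectation (gen_joint_xyz X Y Z P PZ g) (\<lambda>w. elog (1 - D (fst w, snd (snd w)))) =
    - enn2ereal (\<integral>\<^sup>+ w. nlog (1 - D (fst w, snd (snd w))) \<partial>gen_joint_xyz X Y Z P PZ g)"
    using D01 by (intro ereal_expectation_elog) (auto simp: space_gen_joint_xyz space_pair_measure)
  moreover have "(\<integral>\<^sup>+ w. nlog (1 - D (fst w, snd (snd w))) \<partial>gen_joint_xyz X Y Z P PZ g) =
    (\<integral>\<^sup>+ w. nlog (1 - D w) \<partial>gen_joint_xz X Y Z P PZ g)"
    by (subst nn_integral_gen_joint_xz) (auto simp: split_beta')
  ultimately show ?thesis
    by (simp add: loss_xz_def gan_cost_def split_beta' uminus_enn2ereal_add)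
qed

lemma loss_xy_eq_gan_cost:
  assumes D: "D \<in> discriminators (X \<Otimes>\<^sub>M Y)"
  shows "loss_xy X Y Z P PZ D g = - enn2ereal (gan_cost P (gen_joint_xy X Y P PZ g) D)"
proof -
  have [measurable]: "D \<in> borel_measurable (X \<Otimes>\<^sub>M Y)"
    and D01: "\<And>w. w \<in> space (X \<Otimes>\<^sub>M Y) \<Longrightarrow> 0 \<le> D w \<and> D w \<le> 1"
    using D by (auto simp: discriminators_def)
  have "ereal_expectation P (\<lambda>w. elog (D w)) = - enn2ereal (\<integral>\<^sup>+ w. nlog (D w) \<partial>P)"
    using D01 sets_eq_imp_space_eq[OF sets_P] by (intro ereal_expectation_elog) auto
  moreover have "ereal_expectation (gen_joint_xyz X Y Z P PZ g) (\<lambda>w. elog (1 - D (fst w, fst (snd w)))) =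
    - enn2ereal (\<integral>\<^sup>+ w. nlog (1 - D (fst w, fst (snd w))) \<partial>gen_joint_xyz X Y Z P PZ g)"
    using D01 by (intro ereal_expectation_elog) (auto simp: space_gen_joint_xyz space_pair_measure)
  moreover have "(\<integral>\<^sup>+ w. nlog (1 - D (fst w, fst (snd w))) \<partial>gen_joint_xyz X Y Z P PZ g) =
    (\<integral>\<^sup>+ w. nlog (1 - D w) \<partial>gen_joint_xy X Y P PZ g)"
    by (subst nn_integral_gen_joint_xy) (auto simp: split_beta')
  ultimately show ?thesis
    by (simp add: loss_xy_def gan_cost_def split_beta' uminus_enn2ereal_add)
qed

lemma gan_value_xz:
  assumes i: "i \<in> X \<rightarrow>\<^sub>M prob_algebra Z"
  shows "\<exists>D. optimal_xz X Y Z P PZ g i D"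
    and "ereal (- (2 * ln 2)) \<le> max_loss_xz X Y Z P PZ g i"
    and "max_loss_xz X Y Z P PZ g i = ereal (- (2 * ln 2)) \<longleftrightarrow>
      inf_joint_xz X Z P i = gen_joint_xz X Y Z P PZ g"
    and "inf_joint_xz X Z P i = gen_joint_xz X Y Z P PZ g \<Longrightarrow> D \<in> discriminators (X \<Otimes>\<^sub>M Z) \<Longrightarrow>
      optimal_xz X Y Z P PZ g i D \<longleftrightarrow> (AE w in inf_joint_xz X Z P i. D w = 1 / 2)"
  using gan_value[of "inf_joint_xz X Z P i" "gen_joint_xz X Y Z P PZ g" "X \<Otimes>\<^sub>M Z"
      "\<lambda>D. loss_xz X Y Z P PZ D g i", OF _ _ _ _ loss_xz_eq_gan_cost[OF i]]
    inf_joint_xz_in_prob_algebra[OF i] gen_joint_xz_in_prob_algebra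
  unfolding optimal_xz_def max_loss_xz_def space_prob_algebra by auto

lemma gan_value_xy:
  shows "\<exists>D. optimal_xy X Y Z P PZ g D"
    and "ereal (- (2 * ln 2)) \<le> max_loss_xy X Y Z P PZ g"
    and "max_loss_xy X Y Z P PZ g = ereal (- (2 * ln 2)) \<longleftrightarrow> P = gen_joint_xy X Y P PZ g"
    and "P = gen_joint_xy X Y P PZ g \<Longrightarrow> D \<in> discriminators (X \<Otimes>\<^sub>M Y) \<Longrightarrow>
      optimal_xy X Y Z P PZ g D \<longleftrightarrow> (AE w in P. D w = 1 / 2)"
  using gan_value[of P "gen_joint_xy X Y P PZ g" "X \<Otimes>\<^sub>M Y"
      "\<lambda>D. loss_xy X Y Z P PZ D g", OF _ _ _ _ loss_xy_eq_gan_cost]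
    P sets_P gen_joint_xy_in_prob_algebra
  unfolding optimal_xy_def max_loss_xy_def space_prob_algebra by auto

end

section \<open>Matching points and global minima\<close>

text \<open>With constant kernels both joint laws are the product of \<open>p(x)\<close> and
  \<open>p(z)\<close>, drawn in opposite orders; \<open>bind_rotate\<close> exchanges the
  draws.\<close>

lemma ex_matching_xz:
  "\<exists>g \<in> Y \<Otimes>\<^sub>M Z \<rightarrow>\<^sub>M prob_algebra X. \<exists>i \<in> X \<rightarrow>\<^sub>M prob_algebra Z.
    inf_joint_xz X Z P i = gen_joint_xz X Y Z P PZ g"
proof (intro bexI)
  let ?g = "\<lambda>_ :: 'y \<times> 'z. marg_x X P" and ?i = "\<lambda>_ :: 'x. PZ"
  show g: "?g \<in> Y \<Otimes>\<^sub>M Z \<rightarrow>\<^sub>M prob_algebra X"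
    by (simp add: space_prob_algebra prob_space_marg_x)
  show i: "?i \<in> X \<rightarrow>\<^sub>M prob_algebra Z"
    using PZ_in_prob_algebra by simp
  interpret PX: prob_space "marg_x X P" by (rule prob_space_marg_x)
  interpret PZ: prob_space PZ by (rule PZ)
  interpret pair_prob_space "marg_x X P" PZ ..
  have "gen_given_z Y P ?g z = marg_x X P" for z
    unfolding gen_given_z_def
    by (rule bind_const'[OF prob_space_marg_y]) (rule PX.subprob_space_axioms)
  moreover have C: "(\<lambda>(x, z). return (X \<Otimes>\<^sub>M Z) (x, z)) \<in> marg_x X P \<Otimes>\<^sub>M PZ \<rightarrow>\<^sub>M subprob_algebra (X \<Otimes>\<^sub>M Z)"
    by measurable
  ultimately show "inf_joint_xz X Z P ?i = gen_joint_xz X Y Z P PZ ?g"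
    unfolding inf_joint_xz_def gen_joint_xz_def by (simp add: bind_rotate[OF C])
qed

text \<open>A generator that ignores \<open>z\<close> and samples from the disintegration of
  \<open>P\<close> given \<open>y\<close>; averaging over \<open>z\<close> leaves the kernel
  unchanged.\<close>

lemma ex_matching_xy:
  assumes X: "standard_borel X"
  shows "\<exists>g \<in> Y \<Otimes>\<^sub>M Z \<rightarrow>\<^sub>M prob_algebra X. P = gen_joint_xy X Y P PZ g"
proof -
  obtain \<kappa> where \<kappa>: "\<kappa> \<in> Y \<rightarrow>\<^sub>M prob_algebra X"
    and P_eq: "P = do {y \<leftarrow> marg_y Y P; x \<leftarrow> \<kappa> y; return (X \<Otimes>\<^sub>M Y) (x, y)}"
    unfolding marg_y_def by (rule standard_borel_disintegration[OF X P sets_P])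
  let ?g = "\<lambda>w :: 'y \<times> 'z. \<kappa> (fst w)"
  have "gen_given_y PZ ?g y = \<kappa> y" if "y \<in> space Y" for y
    unfolding gen_given_y_def fst_conv
    using measurable_space[OF \<kappa> that]
    by (intro bind_const'[OF PZ]) (simp add: space_prob_algebra prob_space_imp_subprob_space)
  then have "gen_joint_xy X Y P PZ ?g = do {y \<leftarrow> marg_y Y P; x \<leftarrow> \<kappa> y; return (X \<Otimes>\<^sub>M Y) (x, y)}"
    unfolding gen_joint_xy_def by (intro bind_cong) (auto simp: space_marg_y)
  with P_eq have "P = gen_joint_xy X Y P PZ ?g" by simp
  moreover have "?g \<in> Y \<Otimes>\<^sub>M Z \<rightarrow>\<^sub>M prob_algebra X"
    using measurable_compose[OF measurable_fst \<kappa>] .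
  ultimately show ?thesis by blast
qed

text \<open>The matching point attains the lower bound \<open>- (2 * ln 2)\<close>, so minimality
  means attaining it, which means equality of the two joint laws.\<close>

lemma global_min_xz_iff:
  assumes g: "g \<in> Y \<Otimes>\<^sub>M Z \<rightarrow>\<^sub>M prob_algebra X" and i: "i \<in> X \<rightarrow>\<^sub>M prob_algebra Z"
  shows "global_min_xz X Y Z P PZ g i \<longleftrightarrow> inf_joint_xz X Z P i = gen_joint_xz X Y Z P PZ g"
proof -
  obtain g' i' where gi': "g' \<in> Y \<Otimes>\<^sub>M Z \<rightarrow>\<^sub>M prob_algebra X" "i' \<in> X \<rightarrow>\<^sub>M prob_algebra Z"
    "inf_joint_xz X Z P i' = gen_joint_xz X Y Z P PZ g'"
    using ex_matching_xz by blast
  then have "max_loss_xz X Y Z P PZ g' i' = ereal (- (2 * ln 2))"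
    using gan_value_xz(3) by blast
  then have "global_min_xz X Y Z P PZ g i \<longleftrightarrow> max_loss_xz X Y Z P PZ g i = ereal (- (2 * ln 2))"
    unfolding global_min_xz_def using g i gi' gan_value_xz(2)
    by (subst is_arg_min_iff_attains[where y="(g', i')" and c="ereal (- (2 * ln 2))"]) auto
  then show ?thesis using gan_value_xz(3)[OF g i] by simp
qed

lemma global_min_xy_iff:
  assumes X: "standard_borel X" and g: "g \<in> Y \<Otimes>\<^sub>M Z \<rightarrow>\<^sub>M prob_algebra X"
  shows "global_min_xy X Y Z P PZ g \<longleftrightarrow> P = gen_joint_xy X Y P PZ g"
proof -
  obtain g' where g': "g' \<in> Y \<Otimes>\<^sub>M Z \<rightarrow>\<^sub>M prob_algebra X" "P = gen_joint_xy X Y P PZ g'"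
    using ex_matching_xy[OF X] by blast
  then have "max_loss_xy X Y Z P PZ g' = ereal (- (2 * ln 2))"
    using gan_value_xy(3) by blast
  then have "global_min_xy X Y Z P PZ g \<longleftrightarrow> max_loss_xy X Y Z P PZ g = ereal (- (2 * ln 2))"
    unfolding global_min_xy_def using g g' gan_value_xy(2)
    by (subst is_arg_min_iff_attains[where y=g' and c="ereal (- (2 * ln 2))"]) auto
  then show ?thesis using gan_value_xy(3)[OF g] by simp
qed

end

theorem theorem3p1:
  fixes X :: "'x measure" and Y :: "'y measure" and Z :: "'z measure"
    and P :: "('x \<times> 'y) measure" and PZ :: "'z measure"
  assumes "standard_borel X" and "standard_borel Y" and "standard_borel Z"
    and "prob_space P" and "sets P = sets (X \<Otimes>\<^sub>M Y)"
    and "prob_space PZ" and "sets PZ = sets Z"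
  shows "(\<forall>g \<in> Y \<Otimes>\<^sub>M Z \<rightarrow>\<^sub>M prob_algebra X. \<forall>i \<in> X \<rightarrow>\<^sub>M prob_algebra Z.
            (\<exists>D. optimal_xz X Y Z P PZ g i D) \<and>
            (global_min_xz X Y Z P PZ g i \<longleftrightarrow> inf_joint_xz X Z P i = gen_joint_xz X Y Z P PZ g) \<and>
            (global_min_xz X Y Z P PZ g i \<longrightarrow>
               (\<forall>D \<in> discriminators (X \<Otimes>\<^sub>M Z). optimal_xz X Y Z P PZ g i D \<longleftrightarrow>
                  (AE w in inf_joint_xz X Z P i. D w = 1 / 2)))) \<and>
         (\<forall>g \<in> Y \<Otimes>\<^sub>M Z \<rightarrow>\<^sub>M prob_algebra X.
            (\<exists>D. optimal_xy X Y Z P PZ g D) \<and>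
            (global_min_xy X Y Z P PZ g \<longleftrightarrow> P = gen_joint_xy X Y P PZ g) \<and>
            (global_min_xy X Y Z P PZ g \<longrightarrow>
               (\<forall>D \<in> discriminators (X \<Otimes>\<^sub>M Y). optimal_xy X Y Z P PZ g D \<longleftrightarrow>
                  (AE w in P. D w = 1 / 2))))"
proof -
  interpret generative_model X Y Z P PZ
    using assms(4-7) by (rule generative_model.intro)
  show ?thesis
    using gan_value_xz(1,4) gan_value_xy(1,4) global_min_xz_iff global_min_xy_iff[OF assms(1)]
    by blast
qed

end
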